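(* Let $f$ be a non-constant meromorphic function on $\mathbb{C}$ with $\sigma_2^{\log}(f)<1$. Then for each $a\in\widehat{\mathbb{C}}$, $$\tilde N_{AW}^{[1]}\!\left(r,\frac{1}{f-a}\right)=\tilde N_{AW}\!\left(r,\frac{1}{f-a}\right)+S_{\log}(r,f)$$ as $r\to\infty$ outside a set $F$ with $\int_F\frac{dt}{t\log t}<\infty$.
   Context: Fix $q\in\mathbb{C}$ with $0<|q|<1$. Every $x\in\mathbb{C}$ is written uniquely as $x=\frac{z+z^{-1}}{2}$ with $|z|\ge 1$ (when $|z|=1$, $z=x+i\sqrt{1-x^2}$). $(\eta_q f)(x)=f\big(\tfrac{q^{1/2}z+q^{-1/2}z^{-1}}{2}\big)$, $(\eta_q^{-1}f)(x)=f\big(\tfrac{q^{-1/2}z+q^{1/2}z^{-1}}{2}\big)$, $\eta_q^0f=f$, $\eta_q^{\pm k}$ the $k$-fold compositions; $(\eta_{q^{\pm k}}f)(x)=f\big(\tfrac{q^{\pm k/2}z+q^{\mp k/2}z^{-1}}{2}\big)$. Askey-Wilson operator $(\mathcal{D}_qf)(x)=\frac{(\eta_qf)(x)-(\eta_q^{-1}f)(x)}{\eta_qx-\eta_q^{-1}x}$ ($x\ne\pm1$; limit at $\pm1$), $\mathcal{D}_q^k=\mathcal{D}_q\circ\mathcal{D}_q^{k-1}$; $(\mathcal{A}_{q^k}f)(x)=\frac{(\eta_{q^k}f)(x)+(\eta_{q^{-k}}f)(x)}{2}$, $\mathcal{A}_{q^0}f=f$. $\nu^0_g(x)\ge0$ is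 the order of zero of $g$ at $x$; $D(0,r)=\{|x|<r\}$. For $a\in\mathbb{C}$: $\tilde n_{AW}(r,\frac1{f-a})=\sum_{x\in D(0,r)}\big(\nu^0_{f-a}(x)-\min\{\nu^0_{f-a}(x),\nu^0_{\eta_q\mathcal{D}_q(f-a)}(x)\}\big)$, and, for $M\in\mathbb{N}$, with $\delta(M)=-1$ if $M$ is odd and $\delta(M)=0$ if $M$ is even, $\tilde n^{[M]}_{AW}(r,\frac1{f-a})=\sum_{x\in D(0,r)}\big(\nu^0_{\eta_q^{\delta(M)}(f-a)}(x)-\min_{0\le t\le M}\nu^0_{\mathcal{A}_{q^{M-t}}\mathcal{D}_q^t(f-a)}(x)\big)$. For $a=\infty$ these are defined with $1/f$ in place of $f-a$. The integrated versions are $\tilde N(r)=\int_0^r\frac{\tilde n(t)-\tilde n(0)}{t}dt+\tilde n(0)\log r$ for $\tilde n=\tilde n_{AW}$, $\tilde n^{[M]}_{AW}$. $T(r,f)$ is the Nevanlinna characteristic, $\sigma_2^{\log}(f)=\limsup_{r\to\infty}\frac{\log^+\log^+T(r,f)}{\log\log r}$, and $S_{\log}(r,f)$ denotes any quantity of the form $O\big(\frac{T(r,f)}{\log\log r}\big)+O(\log r)$. *)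

theory Defs
  imports "HOL-Complex_Analysis.Complex_Analysis" "HOL-Library.Extended_Nat"
begin

definition logp :: "real \<Rightarrow> real" where
  "logp x = (if x \<le> 1 then 0 else ln x)"

definition pole_count :: "(complex \<Rightarrow> complex) \<Rightarrow> real \<Rightarrow> real" where
  "pole_count f t = (\<Sum>x\<in>{x\<in>cball 0 t. is_pole f x}. real (nat (- zorder f x)))"

definition nev_N :: "(complex \<Rightarrow> complex) \<Rightarrow> real \<Rightarrow> real" where
  "nev_N f r = integral {0..r} (\<lambda>t. (pole_count f t - pole_count f 0) / t)
               + pole_count f 0 * ln r"

definition nev_m :: "(complex \<Rightarrow> complex) \<Rightarrow> real \<Rightarrow> real" where
  "nev_m f r = integral {0..2*pi} (\<lambda>\<theta>. logp (cmod (f (complex_of_real r * cis \<theta>)))) / (2*pi)"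

definition nev_T :: "(complex \<Rightarrow> complex) \<Rightarrow> real \<Rightarrow> real" where
  "nev_T f r = nev_m f r + nev_N f r"

definition sigma2_log :: "(complex \<Rightarrow> complex) \<Rightarrow> ereal" where
  "sigma2_log f = Limsup at_top (\<lambda>r. ereal (logp (logp (nev_T f r)) / ln (ln r)))"

definition aw_z :: "complex \<Rightarrow> complex" where
  "aw_z x = (THE z. 1 \<le> cmod z \<and> x = (z + inverse z) / 2
                 \<and> (cmod z = 1 \<longrightarrow> z = x + \<i> * csqrt (1 - x\<^sup>2)))"

text \<open>Point map of eta_{q^k}, where p is the chosen square root q^{1/2}:
  eta_k p k x = (q^{k/2} z + q^{-k/2} z^{-1})/2.  eta_k p 1 is eta_q, eta_k p (-1) is eta_q^{-1}.\<close>
definition eta_k :: "complex \<Rightarrow> int \<Rightarrow> complex \<Rightarrow> complex" where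
  "eta_k p k x = (let z = aw_z x in (p powi k * z + p powi (-k) * inverse z) / 2)"

text \<open>Point map of the k-fold composition eta_q^k (k an integer): (eta_q^k f)(x) = f(eta_iter p k x).\<close>
definition eta_iter :: "complex \<Rightarrow> int \<Rightarrow> complex \<Rightarrow> complex" where
  "eta_iter p k = (if 0 \<le> k then eta_k p 1 ^^ nat k else eta_k p (-1) ^^ nat (-k))"

definition aw_D0 :: "complex \<Rightarrow> (complex \<Rightarrow> complex) \<Rightarrow> complex \<Rightarrow> complex" where
  "aw_D0 p g x = (g (eta_k p 1 x) - g (eta_k p (-1) x)) / (eta_k p 1 x - eta_k p (-1) x)"

definition aw_D :: "complex \<Rightarrow> (complex \<Rightarrow> complex) \<Rightarrow> complex \<Rightarrow> complex" where
  "aw_D p g x = (if x = 1 \<or> x = -1 then Lim (at x) (aw_D0 p g) else aw_D0 p g x)"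

definition aw_Dpow :: "complex \<Rightarrow> nat \<Rightarrow> (complex \<Rightarrow> complex) \<Rightarrow> complex \<Rightarrow> complex" where
  "aw_Dpow p t g = (aw_D p ^^ t) g"

definition aw_A :: "complex \<Rightarrow> nat \<Rightarrow> (complex \<Rightarrow> complex) \<Rightarrow> complex \<Rightarrow> complex" where
  "aw_A p k g = (if k = 0 then g
                 else (\<lambda>x. (g (eta_k p (int k) x) + g (eta_k p (- int k) x)) / 2))"

definition nu0 :: "(complex \<Rightarrow> complex) \<Rightarrow> complex \<Rightarrow> enat" where
  "nu0 g x = (if eventually (\<lambda>y. g y = 0) (at x) then \<infinity> else enat (nat (zorder g x)))"

definition enr :: "enat \<Rightarrow> real" where
  "enr u = (case u of enat n \<Rightarrow> real n | \<infinity> \<Rightarrow> 0)"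

definition delta :: "nat \<Rightarrow> int" where
  "delta M = (if odd M then -1 else 0)"

text \<open>Pointwise summand of tilde n_AW(r, 1/g); nu^0 of eta_q h at x is read as nu^0_h(eta_q x).\<close>
definition aw_n_pt :: "complex \<Rightarrow> (complex \<Rightarrow> complex) \<Rightarrow> complex \<Rightarrow> real" where
  "aw_n_pt p g x = enr (nu0 g x) - enr (min (nu0 g x) (nu0 (aw_D p g) (eta_k p 1 x)))"

definition aw_nM_pt :: "complex \<Rightarrow> nat \<Rightarrow> (complex \<Rightarrow> complex) \<Rightarrow> complex \<Rightarrow> real" where
  "aw_nM_pt p M g x = enr (nu0 g (eta_iter p (delta M) x))
      - enr (Min ((\<lambda>t. nu0 (aw_A p (M - t) (aw_Dpow p t g)) x) ` {0..M}))"

definition disc_count :: "(complex \<Rightarrow> real) \<Rightarrow> real \<Rightarrow> real" where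
  "disc_count h r = (\<Sum>x\<in>{x\<in>ball 0 r. h x \<noteq> 0}. h x)"

text \<open>Integrated counting function; the value "n(0)" is the contribution of the origin.\<close>
definition int_count :: "(complex \<Rightarrow> real) \<Rightarrow> real \<Rightarrow> real" where
  "int_count h r = integral {0..r} (\<lambda>t. (disc_count h t - h 0) / t) + h 0 * ln r"

definition N_AW :: "complex \<Rightarrow> (complex \<Rightarrow> complex) \<Rightarrow> real \<Rightarrow> real" where
  "N_AW p g r = int_count (aw_n_pt p g) r"

definition N_AW_M :: "complex \<Rightarrow> nat \<Rightarrow> (complex \<Rightarrow> complex) \<Rightarrow> real \<Rightarrow> real" where
  "N_AW_M p M g r = int_count (aw_nM_pt p M g) r"

text \<open>f - a for a \<in> \<complex> (Some a), and 1/f for a = \<infinity> (None).\<close>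
fun fsub :: "(complex \<Rightarrow> complex) \<Rightarrow> complex option \<Rightarrow> complex \<Rightarrow> complex" where
  "fsub f None = (\<lambda>x. inverse (f x))"
| "fsub f (Some a) = (\<lambda>x. f x - a)"

end

theory Submission
  imports Defs
begin

text \<open>
  Write \<open>x = J(z)\<close> with the Joukowski map \<open>J(z) = (z + 1/z)/2\<close>, so that \<open>\<eta>\<^sub>q\<close> becomes
  \<open>J(z) \<mapsto> J(p z)\<close>. Near a point \<open>J(z)\<close> let \<open>u = g \<circ> J(p z)\<close> and \<open>v = g \<circ> J(z/p)\<close>. Away from
  finitely many points a common zero of \<open>u + v\<close> and \<open>u - v\<close>, or of \<open>v\<close> and \<open>u - v\<close>, of order at least
  \<open>n\<close> is the same as a common zero of \<open>u\<close> and \<open>v\<close> of order at least \<open>n\<close>. Hence the weight that the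
  first counting function gives to \<open>\<eta>\<^sub>q x\<close> is the weight that the second one gives to \<open>x\<close>, and the two
  integrated counting functions differ by \<open>O(log r)\<close> plus a multiple of the number of zeros of \<open>g\<close> in
  a disc of radius \<open>\<kappa> r\<close>. This number is at most \<open>N(r (log r)\<^sup>2, 1/g) / log log r\<close>; a Borel growth
  lemma, which uses \<open>\<sigma>\<^sub>2 < 1\<close>, replaces the radius by \<open>r\<close> off the exceptional set, and Jensen's formula
  bounds \<open>N(r, 1/g)\<close> by \<open>T(r, f) + O(1)\<close>.
\<close>

subsection \<open>Orders of zeros\<close>

text \<open>\<open>aw_z\<close> jumps across the segment [-1,1], so orders of zeros cannot be
  carried through the eta shifts directly. The average and the difference quotient, however, are
  invariant under z -> 1/z. Near a point \<open>aw_z\<close> may therefore be replaced by an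
  analytic local inverse of J, and the only obstruction left is that J has critical points at z = 1
  and z = -1; their p-shifts account for the finitely many excluded points. The error T/log log r
  comes from enlarging the radius: the larger disc gives each counted zero a kernel weight of at
  least log log r. The exceptional measure dt/(t log t) is d(log log t), the scale on which the bad
  steps of the growth lemma have finite total length. That lemma is applied to N(r, 1/g) + 1, which
  is increasing because every kernel is, and which is at least 1.\<close>

text \<open>Classes O((w - x)^n) are closed under linear combinations, so comparisons of minimal
  orders become linear algebra. The case n = 0 is separate because \<open>nu0\<close> is 0 at a
  pole, where f is not O(1).\<close>

lemma enat_le_nu0_iff:
  assumes "f meromorphic_on {x}"
  shows "enat n \<le> nu0 f x \<longleftrightarrow> n = 0 \<or> f \<in> O[at x](\<lambda>w. (w - x) ^ n)"
proof (cases "eventually (\<lambda>y. f y = 0) (at x)")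
  case True
  have "f \<in> O[at x](\<lambda>w. (w - x) ^ n)"
    by (rule bigoI[of _ 0]) (use True in \<open>auto elim: eventually_mono\<close>)
  with True show ?thesis by (simp add: nu0_def)
next
  case False
  define k where "k = zorder f x"
  from False have fr: "\<exists>\<^sub>F w in at x. f w \<noteq> 0"
    by (simp add: not_eventually)
  from zorder_exist[OF _ _ fr] assms obtain r where r: "zor_poly f x x \<noteq> 0" "r > 0"
      "zor_poly f x holomorphic_on cball x r"
      "\<And>w. w \<in> cball x r - {x} \<Longrightarrow> f w = zor_poly f x w * (w - x) powi k"
    unfolding meromorphic_at_iff k_def by blast
  define g where "g = zor_poly f x"
  note r = r[folded g_def]
  have "isCont g x"
    using r(2,3) by (metis centre_in_ball ball_subset_cball continuous_on_eq_continuous_at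
        holomorphic_on_imp_continuous_on holomorphic_on_subset open_ball)
  hence lim: "(g \<longlongrightarrow> g x) (at x)" by (simp add: isCont_def)
  have "eventually (\<lambda>w. w \<in> ball x r - {x}) (at x)"
    using r(2) by (intro eventually_at_in_open) auto
  hence ev: "eventually (\<lambda>w. w \<noteq> x \<and> f w = g w * (w - x) powi k) (at x)"
    by eventually_elim (use r(4) in auto)
  have gO: "g \<in> O[at x](\<lambda>_. 1)"
    using lim by (intro bigoI_tendsto[where c = "g x"]) auto
  have "f \<in> O[at x](\<lambda>w. (w - x) ^ n) \<longleftrightarrow> (n = 0 \<or> int n \<le> k)" if "n > 0"
  proof
    assume nk: "n = 0 \<or> int n \<le> k"
    hence nk: "int n \<le> k" using that by auto
    have "(\<lambda>w. g w * (w - x) ^ (nat k - n)) \<in> O[at x](\<lambda>w. 1 * 1)"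
    proof (rule landau_o.big.mult[OF gO])
      have "((\<lambda>w. (w - x) ^ (nat k - n)) \<longlongrightarrow> (x - x) ^ (nat k - n)) (at x)"
        by (intro tendsto_intros)
      thus "(\<lambda>w. (w - x) ^ (nat k - n)) \<in> O[at x](\<lambda>w. 1)"
        by (intro bigoI_tendsto) auto
    qed
    hence "(\<lambda>w. g w * (w - x) ^ (nat k - n) * (w - x) ^ n) \<in> O[at x](\<lambda>w. 1 * 1 * (w - x) ^ n)"
      by (rule landau_o.big.mult) auto
    also have "?this \<longleftrightarrow> f \<in> O[at x](\<lambda>w. 1 * 1 * (w - x) ^ n)"
    proof (rule landau_o.big.in_cong)
      show "\<forall>\<^sub>F w in at x. g w * (w - x) ^ (nat k - n) * (w - x) ^ n = f w"
        using ev
      proof eventually_elim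
        case (elim w)
        have "(w - x) powi k = (w - x) ^ nat k" using nk by (simp add: power_int_def)
        also have "\<dots> = (w - x) ^ (nat k - n) * (w - x) ^ n"
          using nk by (simp flip: power_add)
        finally show ?case using elim by simp
      qed
    qed
    finally show "f \<in> O[at x](\<lambda>w. (w - x) ^ n)" by simp
  next
    assume "f \<in> O[at x](\<lambda>w. (w - x) ^ n)"
    then obtain c where c: "eventually (\<lambda>w. norm (f w) \<le> c * norm ((w - x) ^ n)) (at x)"
      by (rule landau_o.bigE)
    \<comment> \<open>If k < n, dividing by (w - x)^k would force g -> 0 at x, against g(x) \<noteq>
      0.\<close>
    show "n = 0 \<or> int n \<le> k"
    proof (rule ccontr)
      assume "\<not> ?thesis"
      hence nk: "k < int n" by auto
      have "\<forall>\<^sub>F w in at x. norm (g w) \<le> c * norm (w - x) ^ nat (int n - k)"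
        using c ev
      proof eventually_elim
        case (elim w)
        hence "norm (g w) * norm (w - x) powi k \<le> c * norm (w - x) powi (int n)"
          by (simp add: norm_mult norm_power_int norm_power)
        also have "int n = k + int (nat (int n - k))" using nk by auto
        also have "norm (w - x) powi (k + int (nat (int n - k)))
            = norm (w - x) powi k * norm (w - x) ^ nat (int n - k)"
          using elim by (simp add: power_int_add flip: power_int_of_nat)
        finally show ?case using elim by (simp add: mult.left_commute)
      qed
      moreover have "((\<lambda>w. c * norm (w - x) ^ nat (int n - k)) \<longlongrightarrow> c * norm (x - x) ^ nat (int n - k)) (at x)"
        by (intro tendsto_intros)
      hence "((\<lambda>w. c * norm (w - x) ^ nat (int n - k)) \<longlongrightarrow> 0) (at x)"
        using nk by (simp add: zero_power)
      ultimately have "(g \<longlongrightarrow> 0) (at x)"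
        by (rule Lim_null_comparison)
      with lim have "g x = 0" using tendsto_unique[of "at x" g] by simp
      thus False using r(1) by simp
    qed
  qed
  moreover have "nu0 f x = enat (nat k)" using False by (simp add: nu0_def k_def)
  moreover have "n \<le> nat k \<longleftrightarrow> n = 0 \<or> int n \<le> k" by arith
  ultimately show ?thesis by auto
qed

lemma enat_eq_iff_all_le: "a = b \<longleftrightarrow> (\<forall>n. enat n \<le> a \<longleftrightarrow> enat n \<le> b)"
proof
  assume *: "\<forall>n. enat n \<le> a \<longleftrightarrow> enat n \<le> b"
  have "a \<le> b \<and> b \<le> a"
  proof (cases a; cases b)
    fix m assume "a = enat m" "b = \<infinity>"
    with *[rule_format, of "Suc m"] show ?thesis by simp
  next
    fix m assume "a = \<infinity>" "b = enat m"
    with *[rule_format, of "Suc m"] show ?thesis by simp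
  next
    fix m n assume "a = enat m" "b = enat n"
    with *[rule_format, of m] *[rule_format, of n] show ?thesis by simp
  qed auto
  thus "a = b" by (intro antisym) auto
qed auto

lemma nu0_cong:
  assumes "eventually (\<lambda>y. f y = g y) (at x)"
  shows "nu0 f x = nu0 g x"
proof -
  have "eventually (\<lambda>y. f y = 0) (at x) \<longleftrightarrow> eventually (\<lambda>y. g y = 0) (at x)"
    by (rule eventually_subst) (use assms in \<open>auto elim: eventually_mono\<close>)
  moreover have "zorder f x = zorder g x"
    using assms by (intro zorder_cong) auto
  ultimately show ?thesis by (simp add: nu0_def)
qed

lemma zorder_simple_zero:
  assumes "\<phi> analytic_on {x}" "deriv \<phi> x \<noteq> 0"
  shows "zorder (\<lambda>y. \<phi> y - \<phi> x) x = 1" "eventually (\<lambda>y. \<phi> y \<noteq> \<phi> x) (at x)"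
proof -
  obtain s where s: "s > 0" "\<phi> holomorphic_on ball x s"
    using assms(1) by (auto simp: analytic_at_ball)
  have fd: "\<phi> field_differentiable at x" 
    using s by (metis centre_in_ball holomorphic_on_imp_differentiable_at open_ball)
  have d: "deriv (\<lambda>y. \<phi> y - \<phi> x) x = deriv \<phi> x"
    using fd by (subst deriv_diff) auto
  show "zorder (\<lambda>y. \<phi> y - \<phi> x) x = 1"
  proof (rule zorder_zero_eqI'[where n = 1, simplified])
    show "(\<lambda>y. \<phi> y - \<phi> x) analytic_on {x}" by (intro analytic_intros assms(1))
  qed (use assms d in auto)
  have "(\<phi> has_field_derivative deriv \<phi> x) (at x)"
    using fd by (simp add: DERIV_deriv_iff_field_differentiable)
  hence "((\<lambda>y. (\<phi> y - \<phi> x) / (y - x)) \<longlongrightarrow> deriv \<phi> x) (at x)"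
    by (simp add: has_field_derivative_iff)
  hence "eventually (\<lambda>y. (\<phi> y - \<phi> x) / (y - x) \<noteq> 0) (at x)"
    using assms(2) by (rule tendsto_imp_eventually_ne)
  thus "eventually (\<lambda>y. \<phi> y \<noteq> \<phi> x) (at x)" by eventually_elim auto
qed

text \<open>\<open>zorder\<close> of the composition is multiplied by the order of
  \<open>\<phi> y - \<phi> x\<close> at x, which is 1 because the derivative does not
  vanish.\<close>

lemma nu0_compose:
  assumes f: "f meromorphic_on {\<phi> x}" and \<phi>: "\<phi> analytic_on {x}" "deriv \<phi> x \<noteq> 0"
  shows "nu0 (\<lambda>y. f (\<phi> y)) x = nu0 f (\<phi> x)"
proof -
  note z = zorder_simple_zero[OF \<phi>]
  have "isCont \<phi> x" using \<phi>(1) by (rule analytic_at_imp_isCont)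
  hence lim: "filterlim \<phi> (at (\<phi> x)) (at x)"
    using z(2) by (simp add: filterlim_at isCont_def)
  show ?thesis
  proof (cases "eventually (\<lambda>y. f y = 0) (at (\<phi> x))")
    case True
    with eventually_compose_filterlim[OF this lim] show ?thesis by (simp add: nu0_def)
  next
    case False
    have ev: "eventually (\<lambda>y. f y \<noteq> 0) (at (\<phi> x))"
    proof (rule ccontr)
      assume "\<not> ?thesis"
      hence "\<exists>\<^sub>F y in at (\<phi> x). f y = 0" by (simp add: frequently_def)
      with f False show False
        using not_essential_frequently_0_imp_eventually_0 unfolding meromorphic_at_iff by blast
    qed
    from eventually_compose_filterlim[OF this lim]
    have "\<not> eventually (\<lambda>y. f (\<phi> y) = 0) (at x)"
      using eventually_frequently[of "at x" "\<lambda>y. f (\<phi> y) \<noteq> 0"] by (auto simp: frequently_def)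
    moreover have "zorder (f \<circ> \<phi>) x = zorder f (\<phi> x) * zorder (\<lambda>y. \<phi> y - \<phi> x) x"
      using f by (intro zorder_compose' \<phi> ev z(2)) (auto simp: meromorphic_at_iff)
    ultimately show ?thesis using False z(1) by (simp add: nu0_def o_def)
  qed
qed

text \<open>Near x both d and 1/d are bounded, so division by d preserves each class O((w - x)^n),
  and u and v are recovered linearly from either pair. Arguing for every n also covers infinite
  orders and poles.\<close>

lemma nu0_min_sum_diff:
  assumes uv: "u meromorphic_on {x}" "v meromorphic_on {x}" and d: "d analytic_on {x}" "d x \<noteq> 0"
  shows "min (nu0 (\<lambda>y. (u y + v y) / 2) x) (nu0 (\<lambda>y. (u y - v y) / d y) x) = min (nu0 u x) (nu0 v x)"
    and "min (nu0 v x) (nu0 (\<lambda>y. (u y - v y) / d y) x) = min (nu0 u x) (nu0 v x)"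
proof -
  have mero: "(\<lambda>y. (u y + v y) / 2) meromorphic_on {x}" "(\<lambda>y. (u y - v y) / d y) meromorphic_on {x}"
    by (intro meromorphic_intros uv analytic_on_imp_meromorphic_on[OF d(1)])+
  have dc: "isCont d x" using d(1) by (rule analytic_at_imp_isCont)
  have dne: "eventually (\<lambda>y. d y \<noteq> 0) (at x)"
    using dc d(2) by (auto simp: isCont_def intro: tendsto_imp_eventually_ne)
  have "((\<lambda>y. inverse (d y)) \<longlongrightarrow> inverse (d x)) (at x)"
    using dc d(2) by (auto simp: isCont_def intro: tendsto_inverse)
  hence dO: "d \<in> O[at x](\<lambda>_. 1)" "(\<lambda>y. inverse (d y)) \<in> O[at x](\<lambda>_. 1)"
    using dc bigoI_tendsto[of d "\<lambda>_. 1" "d x" "at x"]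
      bigoI_tendsto[of "\<lambda>y. inverse (d y)" "\<lambda>_. 1" "inverse (d x)" "at x"]
    by (auto simp: isCont_def)
  have diff: "(\<lambda>y. (u y - v y) / d y) \<in> O[at x](h) \<longleftrightarrow> (\<lambda>y. u y - v y) \<in> O[at x](h)" for h
  proof
    assume "(\<lambda>y. (u y - v y) / d y) \<in> O[at x](h)"
    from landau_o.big.mult[OF this dO(1)] have "(\<lambda>y. (u y - v y) / d y * d y) \<in> O[at x](h)" by simp
    also have "?this \<longleftrightarrow> (\<lambda>y. u y - v y) \<in> O[at x](h)"
      using dne by (intro landau_o.big.in_cong) (auto elim: eventually_mono)
    finally show "(\<lambda>y. u y - v y) \<in> O[at x](h)" .
  next
    assume "(\<lambda>y. u y - v y) \<in> O[at x](h)"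
    from landau_o.big.mult[OF this dO(2)] show "(\<lambda>y. (u y - v y) / d y) \<in> O[at x](h)"
      by (simp add: field_simps)
  qed
  have sum: "(\<lambda>y. (u y + v y) / 2) \<in> O[at x](h) \<longleftrightarrow> (\<lambda>y. u y + v y) \<in> O[at x](h)" for h by simp
  have a1: "u \<in> O[at x](h) \<and> v \<in> O[at x](h) \<longleftrightarrow>
        (\<lambda>y. u y + v y) \<in> O[at x](h) \<and> (\<lambda>y. u y - v y) \<in> O[at x](h)" for h
  proof
    assume A: "(\<lambda>y. u y + v y) \<in> O[at x](h) \<and> (\<lambda>y. u y - v y) \<in> O[at x](h)"
    have "(\<lambda>y. (u y + v y) + (u y - v y)) \<in> O[at x](h)"
      by (rule sum_in_bigo(1)) (use A in auto)
    hence "(\<lambda>y. 2 * u y) \<in> O[at x](h)" by simp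
    moreover have "(\<lambda>y. (u y + v y) - (u y - v y)) \<in> O[at x](h)"
      by (rule sum_in_bigo(2)) (use A in auto)
    hence "(\<lambda>y. 2 * v y) \<in> O[at x](h)" by simp
    ultimately show "u \<in> O[at x](h) \<and> v \<in> O[at x](h)" by simp
  qed (blast intro: sum_in_bigo)
  have a2: "u \<in> O[at x](h) \<and> v \<in> O[at x](h) \<longleftrightarrow>
        v \<in> O[at x](h) \<and> (\<lambda>y. u y - v y) \<in> O[at x](h)" for h
  proof
    assume A: "v \<in> O[at x](h) \<and> (\<lambda>y. u y - v y) \<in> O[at x](h)"
    have "(\<lambda>y. v y + (u y - v y)) \<in> O[at x](h)"
      using A by (intro sum_in_bigo(1)) auto
    with A show "u \<in> O[at x](h) \<and> v \<in> O[at x](h)" by simp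
  qed (auto intro: sum_in_bigo)
  show "min (nu0 (\<lambda>y. (u y + v y) / 2) x) (nu0 (\<lambda>y. (u y - v y) / d y) x) = min (nu0 u x) (nu0 v x)"
    unfolding enat_eq_iff_all_le min.bounded_iff enat_le_nu0_iff[OF mero(1)] enat_le_nu0_iff[OF mero(2)]
      enat_le_nu0_iff[OF uv(1)] enat_le_nu0_iff[OF uv(2)] diff sum
    using a1 by blast
  show "min (nu0 v x) (nu0 (\<lambda>y. (u y - v y) / d y) x) = min (nu0 u x) (nu0 v x)"
    unfolding enat_eq_iff_all_le min.bounded_iff enat_le_nu0_iff[OF mero(1)] enat_le_nu0_iff[OF mero(2)]
      enat_le_nu0_iff[OF uv(1)] enat_le_nu0_iff[OF uv(2)] diff sum
    using a2 by blast
qed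

subsection \<open>The Joukowski map and the pointwise summands\<close>

definition joukowski :: "complex \<Rightarrow> complex" where
  "joukowski z = (z + inverse z) / 2"

lemma joukowski_inverse [simp]: "joukowski (inverse z) = joukowski z"
  by (simp add: joukowski_def add.commute)

lemma joukowski_eq_iff:
  assumes "z \<noteq> 0" "w \<noteq> 0"
  shows "joukowski z = joukowski w \<longleftrightarrow> z = w \<or> z = inverse w"
proof -
  have "(joukowski z - joukowski w) * (2 * z * w) = (z - w) * (z * w - 1)"
    using assms by (simp add: joukowski_def field_simps)
  hence "joukowski z = joukowski w \<longleftrightarrow> (z - w) * (z * w - 1) = 0"
    using assms by (metis eq_iff_diff_eq_0 mult_eq_0_iff zero_neq_numeral)
  also have "\<dots> \<longleftrightarrow> z = w \<or> z * w = 1" by simp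
  also have "z * w = 1 \<longleftrightarrow> z = inverse w"
    using assms by (simp add: field_simps)
  finally show ?thesis .
qed

lemma joukowski_surj: obtains z where "1 \<le> cmod z" "joukowski z = x"
proof -
  \<comment> \<open>x + s and x - s are the roots of w^2 - 2 x w + 1. Their product is 1, so one of
    them has modulus at least 1.\<close>
  define s where "s = csqrt (x\<^sup>2 - 1)"
  have s: "s\<^sup>2 = x\<^sup>2 - 1" by (simp add: s_def)
  define w where "w = x + s"
  have w: "w * (x - s) = 1" using s by (simp add: w_def algebra_simps power2_eq_square)
  hence w0: "w \<noteq> 0" and i: "inverse w = x - s" by (auto simp: inverse_unique)
  have J: "joukowski w = x" by (simp add: joukowski_def i) (simp add: w_def)
  show ?thesis
  proof (cases "1 \<le> cmod w")
    case True
    with J that show ?thesis by blast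
  next
    case False
    hence "1 \<le> cmod (inverse w)" using w0 by (simp add: norm_inverse one_le_inverse_iff)
    with J that[of "inverse w"] show ?thesis by simp
  qed
qed

lemma aw_z_props: "1 \<le> cmod (aw_z x)" "joukowski (aw_z x) = x"
proof -
  obtain z0 where z0: "1 \<le> cmod z0" "joukowski z0 = x" by (rule joukowski_surj)
  define P where "P = (\<lambda>z. 1 \<le> cmod z \<and> x = (z + inverse z) / 2
                 \<and> (cmod z = 1 \<longrightarrow> z = x + \<i> * csqrt (1 - x\<^sup>2)))"
  have z0': "z0 \<noteq> 0" using z0 by auto
  have sols: "z = z0 \<or> z = inverse z0" if "1 \<le> cmod z" "x = (z + inverse z) / 2" for z
  proof -
    have "z \<noteq> 0" using that by auto
    thus ?thesis using joukowski_eq_iff[of z z0] z0' z0 that by (auto simp: joukowski_def)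
  qed
  have "\<exists>!z. P z"
  proof (cases "cmod z0 = 1")
    case True
    \<comment> \<open>On the unit circle both preimages are admissible and this formula breaks the
      tie. Its value must be shown to be a preimage; it then has modulus 1, being \<open>z0\<close>
      or its inverse.\<close>
    define w where "w = x + \<i> * csqrt (1 - x\<^sup>2)"
    have "w * (x - \<i> * csqrt (1 - x\<^sup>2)) = x\<^sup>2 + (csqrt (1 - x\<^sup>2))\<^sup>2"
      by (simp add: w_def algebra_simps power2_eq_square)
    hence m: "w * (x - \<i> * csqrt (1 - x\<^sup>2)) = 1" by simp
    hence i: "inverse w = x - \<i> * csqrt (1 - x\<^sup>2)" and w0: "w \<noteq> 0" by (auto simp: inverse_unique)
    have J: "x = (w + inverse w) / 2" unfolding i by (simp add: w_def)
    hence "joukowski w = joukowski z0" using z0 by (simp add: joukowski_def)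
    hence "w = z0 \<or> w = inverse z0" using joukowski_eq_iff[of w z0] w0 z0' by simp
    hence "cmod w = 1" using True by (auto simp: norm_inverse)
    have "P w" unfolding P_def using J \<open>cmod w = 1\<close> by (auto simp: w_def)
    moreover have "z = w" if "P z" for z
    proof -
      have "cmod (inverse z0) = 1" using True by (simp add: norm_inverse)
      hence "cmod z = 1" using sols[of z] that True unfolding P_def by metis
      thus ?thesis using that by (simp add: P_def w_def)
    qed
    ultimately show ?thesis by blast
  next
    case False
    hence gt: "cmod z0 > 1" using z0 by simp
    have "P z0" using z0 False by (auto simp: P_def joukowski_def)
    moreover have "z = z0" if "P z" for z
    proof -
      have "cmod (inverse z0) < 1" using gt by (simp add: norm_inverse inverse_less_1_iff)
      thus ?thesis using sols[of z] that by (auto simp: P_def)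
    qed
    ultimately show ?thesis by blast
  qed
  hence "P (aw_z x)" unfolding aw_z_def P_def by (rule theI')
  thus "1 \<le> cmod (aw_z x)" "joukowski (aw_z x) = x" by (auto simp: P_def joukowski_def)
qed

lemma aw_z_nonzero [simp]: "aw_z x \<noteq> 0"
  using aw_z_props(1)[of x] by auto

lemma aw_z_joukowski_cases:
  assumes "z \<noteq> 0"
  shows "aw_z (joukowski z) = z \<or> aw_z (joukowski z) = inverse z"
  using joukowski_eq_iff[of "aw_z (joukowski z)" z] aw_z_props(2) assms by auto

text \<open>The other preimage has modulus below 1. On the unit circle the tie-break may return
  either one, hence the strict inequality.\<close>

lemma aw_z_joukowski:
  assumes "1 < cmod z"
  shows "aw_z (joukowski z) = z"
proof -
  have "cmod (inverse z) < 1" "z \<noteq> 0" using assms by (auto simp: norm_inverse inverse_less_1_iff)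
  thus ?thesis using aw_z_joukowski_cases[of z] aw_z_props(1)[of "joukowski z"] by auto
qed

section \<open>The Askey-Wilson operators in the Joukowski coordinate\<close>

lemma eta_k_conv_joukowski:
  assumes "p \<noteq> 0"
  shows "eta_k p 1 x = joukowski (p * aw_z x)" "eta_k p (-1) x = joukowski (aw_z x / p)"
  using assms by (simp_all add: eta_k_def Let_def joukowski_def divide_simps)

text \<open>Replacing z by 1/z swaps the two shifted points: the average is symmetric, and in the
  quotient numerator and denominator both change sign. So the formulas hold for either preimage,
  whichever \<open>aw_z\<close> selects.\<close>

lemma aw_joukowski:
  assumes "p \<noteq> 0" "z \<noteq> 0"
  shows "aw_A p 1 g (joukowski z) = (g (joukowski (p * z)) + g (joukowski (z / p))) / 2"
    and "aw_D0 p g (joukowski z) = (g (joukowski (p * z)) - g (joukowski (z / p))) /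
           ((p - inverse p) * (z - inverse z) / 2)"
proof -
  have e: "joukowski (p * inverse z) = joukowski (z / p)" "joukowski (inverse z / p) = joukowski (p * z)"
    using joukowski_inverse[of "z / p"] joukowski_inverse[of "p * z"]  by (simp_all add: field_simps)
  have d: "joukowski (p * z) - joukowski (z / p) = (p - inverse p) * (z - inverse z) / 2"
    using assms by (simp add: joukowski_def field_simps)
  have "(g (joukowski (z / p)) - g (joukowski (p * z))) / (joukowski (z / p) - joukowski (p * z))
     = (g (joukowski (p * z)) - g (joukowski (z / p))) / (joukowski (p * z) - joukowski (z / p))"
    by (metis minus_diff_eq minus_divide_divide)
  thus "aw_D0 p g (joukowski z) = (g (joukowski (p * z)) - g (joukowski (z / p))) /
           ((p - inverse p) * (z - inverse z) / 2)"
    unfolding d[symmetric]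
    using aw_z_joukowski_cases[OF assms(2)] assms(1)
    by (auto simp: aw_D0_def eta_k_conv_joukowski e)
  show "aw_A p 1 g (joukowski z) = (g (joukowski (p * z)) + g (joukowski (z / p))) / 2"
    using aw_z_joukowski_cases[OF assms(2)] assms(1)
    by (auto simp: aw_A_def eta_k_conv_joukowski e add.commute)
qed

lemma joukowski_has_derivative:
  "z \<noteq> 0 \<Longrightarrow> (joukowski has_field_derivative (1 - inverse (z\<^sup>2)) / 2) (at z)"
  unfolding joukowski_def [abs_def]
  by (auto intro!: derivative_eq_intros simp: power2_eq_square)

lemma joukowski_analytic: "z \<noteq> 0 \<Longrightarrow> joukowski analytic_on {z}"
  unfolding joukowski_def [abs_def] by (intro analytic_intros) auto

text \<open>The analytic substitute for \<open>aw_z\<close>, through any prescribed preimage that is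
  not a critical point of J.\<close>

lemma joukowski_local_branch:
  assumes z0: "z0 \<noteq> 0" "z0\<^sup>2 \<noteq> 1"
  obtains Z where "Z analytic_on {joukowski z0}" "Z (joukowski z0) = z0"
    "eventually (\<lambda>y. Z y \<noteq> 0 \<and> joukowski (Z y) = y) (nhds (joukowski z0))"
    "deriv Z (joukowski z0) \<noteq> 0"
proof -
  define x where "x = joukowski z0"
  define s where "s = z0 - x"
  have s2: "s\<^sup>2 = x\<^sup>2 - 1"
    using z0 by (simp add: s_def x_def joukowski_def field_simps power2_eq_square)
  have "s = (z0\<^sup>2 - 1) / (2 * z0)"
    using z0 by (simp add: s_def x_def joukowski_def field_simps power2_eq_square)
  hence s0: "s \<noteq> 0" using z0 by simp
  have x1: "x\<^sup>2 - 1 \<noteq> 0" using s0 s2 by (metis zero_eq_power2)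
  \<comment> \<open>The second summand is the square root of y^2 - 1 that equals s at y = x. The
    quotient under \<open>csqrt\<close> is 1 there, away from the branch cut.\<close>
  define Z where "Z = (\<lambda>y. y + s * csqrt ((y\<^sup>2 - 1) / (x\<^sup>2 - 1)))"
  have ana: "Z analytic_on {x}"
    unfolding Z_def using x1 by (intro analytic_intros) auto
  have Zx: "Z x = z0" using x1 by (simp add: Z_def s_def)
  have inv: "Z y * (y - s * csqrt ((y\<^sup>2 - 1) / (x\<^sup>2 - 1))) = 1" for y
  proof -
    have "Z y * (y - s * csqrt ((y\<^sup>2 - 1) / (x\<^sup>2 - 1))) = y\<^sup>2 - s\<^sup>2 * (csqrt ((y\<^sup>2 - 1) / (x\<^sup>2 - 1)))\<^sup>2"
      by (simp add: Z_def algebra_simps power2_eq_square)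
    also have "\<dots> = 1" using x1 by (simp add: s2)
    finally show ?thesis .
  qed
  have Zn: "Z y \<noteq> 0" for y using inv[of y] by auto
  have JZ: "joukowski (Z y) = y" for y
  proof -
    have "inverse (Z y) = y - s * csqrt ((y\<^sup>2 - 1) / (x\<^sup>2 - 1))"
      using inv[of y] by (rule inverse_unique)
    thus ?thesis by (simp add: joukowski_def) (simp add: Z_def)
  qed
  have "Z field_differentiable at x" using ana by (rule analytic_on_imp_differentiable_at) simp
  hence dZ: "(Z has_field_derivative deriv Z x) (at x)"
    by (simp add: DERIV_deriv_iff_field_differentiable)
  have "((\<lambda>y. joukowski (Z y)) has_field_derivative (1 - inverse ((Z x)\<^sup>2)) / 2 * deriv Z x) (at x)"
    by (rule DERIV_chain2[OF joukowski_has_derivative[OF Zn] dZ])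
  hence "((\<lambda>y. y) has_field_derivative (1 - inverse ((Z x)\<^sup>2)) / 2 * deriv Z x) (at x)"
    by (simp add: JZ)
  hence "(1 - inverse ((Z x)\<^sup>2)) / 2 * deriv Z x = 1"
    using DERIV_ident DERIV_unique by blast
  hence "deriv Z x \<noteq> 0" by auto
  with ana Zx Zn JZ that[of Z] show ?thesis by (simp add: x_def)
qed

text \<open>J' vanishes only at 1 and -1, so the last hypothesis gives y -> J(c Z(y)) a nonzero
  derivative at x, and composing with it preserves orders.\<close>

lemma nu0_joukowski_scaled:
  assumes g: "g meromorphic_on UNIV" and Z: "Z analytic_on {x}" "Z x = z0" "deriv Z x \<noteq> 0"
    and z0: "z0 \<noteq> 0" "c \<noteq> 0" "(c * z0)\<^sup>2 \<noteq> 1"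
  shows "(\<lambda>y. g (joukowski (c * Z y))) meromorphic_on {x}"
    "nu0 (\<lambda>y. g (joukowski (c * Z y))) x = nu0 g (joukowski (c * z0))"
proof -
  let ?\<phi> = "\<lambda>y. joukowski (c * Z y)"
  have ana: "?\<phi> analytic_on {x}"
  proof -
    have "joukowski \<circ> (\<lambda>y. c * Z y) analytic_on {x}"
      by (rule analytic_on_compose) (use Z z0 in \<open>auto intro!: analytic_intros joukowski_analytic\<close>)
    thus ?thesis by (simp add: o_def)
  qed
  show "(\<lambda>y. g (joukowski (c * Z y))) meromorphic_on {x}"
    by (rule meromorphic_on_compose[OF g ana]) auto
  have dZ: "(Z has_field_derivative deriv Z x) (at x)"
    using analytic_on_imp_differentiable_at[OF Z(1)] by (simp add: DERIV_deriv_iff_field_differentiable)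
  have "(?\<phi> has_field_derivative (1 - inverse ((c * Z x)\<^sup>2)) / 2 * (c * deriv Z x)) (at x)"
    by (rule DERIV_chain2[OF joukowski_has_derivative DERIV_cmult[OF dZ]]) (use Z z0 in auto)
  hence "deriv ?\<phi> x = (1 - inverse ((c * Z x)\<^sup>2)) / 2 * (c * deriv Z x)"
    by (rule DERIV_imp_deriv)
  also have "1 - inverse ((c * Z x)\<^sup>2) \<noteq> 0"
    using z0 Z(2) by (metis eq_iff_diff_eq_0 inverse_eq_1_iff)
  hence "(1 - inverse ((c * Z x)\<^sup>2)) / 2 * (c * deriv Z x) \<noteq> 0"
    using Z z0 by simp
  finally have "deriv ?\<phi> x \<noteq> 0" .
  moreover have "g meromorphic_on {?\<phi> x}" using g by (rule meromorphic_on_subset) auto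
  ultimately show "nu0 (\<lambda>y. g (joukowski (c * Z y))) x = nu0 g (joukowski (c * z0))"
    using nu0_compose[OF _ ana] Z(2) by simp
qed

text \<open>Excluded are the \<open>z0\<close> where the local inverse fails and the denominator of
  \<open>aw_D\<close> vanishes, and those where a shifted argument is a critical point of J.
  Preimages inside the unit disc are allowed, as \<open>p * aw_z x\<close> may be one.\<close>

lemma nu0_AW_min:
  assumes g: "g meromorphic_on UNIV" and p: "p \<noteq> 0" "p\<^sup>2 \<noteq> 1"
    and z0: "z0 \<noteq> 0" "z0\<^sup>2 \<noteq> 1" "(p * z0)\<^sup>2 \<noteq> 1" "(z0 / p)\<^sup>2 \<noteq> 1"
  defines "x \<equiv> joukowski z0"
  defines "m \<equiv> min (nu0 g (joukowski (p * z0))) (nu0 g (joukowski (z0 / p)))"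
  shows "min (nu0 (aw_A p 1 g) x) (nu0 (aw_D p g) x) = m"
    and "min (nu0 g (joukowski (z0 / p))) (nu0 (aw_D p g) x) = m"
proof -
  obtain Z where Z: "Z analytic_on {x}" "Z x = z0"
    "eventually (\<lambda>y. Z y \<noteq> 0 \<and> joukowski (Z y) = y) (nhds x)" "deriv Z x \<noteq> 0"
    unfolding x_def using joukowski_local_branch[OF z0(1,2)] by blast
  define u v where "u = (\<lambda>y. g (joukowski (p * Z y)))" "v = (\<lambda>y. g (joukowski (inverse p * Z y)))"
  define d where "d = (\<lambda>y. (p - inverse p) * (Z y - inverse (Z y)) / 2)"
  have u: "u meromorphic_on {x}" "nu0 u x = nu0 g (joukowski (p * z0))"
    unfolding u_v_def by (rule nu0_joukowski_scaled[OF g Z(1,2,4)]; use p z0 in simp)+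
  have v: "v meromorphic_on {x}" "nu0 v x = nu0 g (joukowski (z0 / p))"
    using nu0_joukowski_scaled[OF g Z(1,2,4), of "inverse p"] p z0
    by (simp_all add: u_v_def field_simps)
  have d: "d analytic_on {x}" "d x \<noteq> 0"
  proof -
    show "d analytic_on {x}" unfolding d_def using Z z0 by (intro analytic_intros) auto
    have "p - inverse p \<noteq> 0" using p by (auto simp: field_simps power2_eq_square)
    moreover have "z0 - inverse z0 \<noteq> 0" using z0 by (auto simp: field_simps power2_eq_square)
    ultimately show "d x \<noteq> 0" using Z(2) by (simp add: d_def)
  qed
  have xne: "x \<noteq> 1" "x \<noteq> -1"
    using joukowski_eq_iff[OF z0(1), of 1] joukowski_eq_iff[OF z0(1), of "-1"] z0(2)
    by (auto simp: x_def joukowski_def)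
  have Zev: "eventually (\<lambda>y. Z y \<noteq> 0 \<and> joukowski (Z y) = y) (at x)"
    using Z(3) by (auto simp: eventually_at_filter elim: eventually_mono)
  have A: "nu0 (aw_A p 1 g) x = nu0 (\<lambda>y. (u y + v y) / 2) x"
  proof (rule nu0_cong)
    show "\<forall>\<^sub>F y in at x. aw_A p 1 g y = (u y + v y) / 2"
      using Zev
    proof eventually_elim
      case (elim y)
      hence "aw_A p 1 g y = aw_A p 1 g (joukowski (Z y))" by simp
    also have "\<dots> = (g (joukowski (p * Z y)) + g (joukowski (Z y / p))) / 2"
      using elim by (intro aw_joukowski(1)[OF p(1)]) auto
    also have "Z y / p = inverse p * Z y" by (simp add: field_simps)
    finally show ?case by (simp only: u_v_def)
    qed
  qed
  have "eventually (\<lambda>y. y \<in> -{1, -1}) (at x)"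
    using xne by (intro eventually_at_in_open') (auto simp: open_Compl)
  hence "\<forall>\<^sub>F y in at x. aw_D p g y = (u y - v y) / d y"
    using Zev
  proof eventually_elim
    case (elim y)
    hence "aw_D p g y = aw_D0 p g (joukowski (Z y))" by (simp add: aw_D_def)
    also have "\<dots> = (g (joukowski (p * Z y)) - g (joukowski (Z y / p))) / d y"
      unfolding d_def using elim by (intro aw_joukowski(2)[OF p(1)]) auto
    also have "Z y / p = inverse p * Z y" by (simp add: field_simps)
    finally show ?case by (simp only: u_v_def)
  qed
  hence D: "nu0 (aw_D p g) x = nu0 (\<lambda>y. (u y - v y) / d y) x"
    by (rule nu0_cong)
  show "min (nu0 (aw_A p 1 g) x) (nu0 (aw_D p g) x) = m"
    using nu0_min_sum_diff(1)[OF u(1) v(1) d] by (simp only: A D u(2) v(2) m_def)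
  show "min (nu0 g (joukowski (z0 / p))) (nu0 (aw_D p g) x) = m"
    using nu0_min_sum_diff(2)[OF u(1) v(1) d] by (simp only: D u(2) v(2) m_def)
qed

text \<open>The common form of both summands: away from finitely many points, \<open>aw_n_pt\<close> at \<open>x\<close> is this
  weight at \<open>p * aw_z x\<close>, and \<open>aw_nM_pt\<close> at \<open>x\<close> is this weight at \<open>aw_z x\<close>.\<close>

definition aw_weight :: "complex \<Rightarrow> (complex \<Rightarrow> complex) \<Rightarrow> complex \<Rightarrow> real" where
  "aw_weight p g z = enr (nu0 g (joukowski (z / p)))
     - enr (min (nu0 g (joukowski (p * z))) (nu0 g (joukowski (z / p))))"

text \<open>For M = 1 the minimum runs over the average (t = 0) and the difference operator (t = 1),
  and \<open>delta 1 = -1\<close> places the first term at J(z/p).\<close>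

lemma aw_nM_pt_eq_weight:
  assumes g: "g meromorphic_on UNIV" and p: "p \<noteq> 0" "p\<^sup>2 \<noteq> 1"
    and "(aw_z x)\<^sup>2 \<noteq> 1" "(p * aw_z x)\<^sup>2 \<noteq> 1" "(aw_z x / p)\<^sup>2 \<noteq> 1"
  shows "aw_nM_pt p 1 g x = aw_weight p g (aw_z x)"
proof -
  have "(\<lambda>t. nu0 (aw_A p (1 - t) (aw_Dpow p t g)) x) ` {0..1}
      = {nu0 (aw_A p 1 g) x, nu0 (aw_D p g) x}"
  proof -
    have "{0..1::nat} = {0, 1}" by auto
    thus ?thesis by (simp add: aw_Dpow_def aw_A_def)
  qed
  moreover have "eta_iter p (delta 1) x = joukowski (aw_z x / p)"
    by (simp add: eta_iter_def delta_def eta_k_conv_joukowski(2)[OF p(1)])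
  ultimately show ?thesis
    using nu0_AW_min(1)[OF g p aw_z_nonzero assms(4-6)] 
    by (simp add: aw_nM_pt_def aw_weight_def aw_z_props(2))
qed

text \<open>The second minimum formula is used at the preimage \<open>p * aw_z x\<close> of eta_q x,
  whose shift by 1/p leads back to x.\<close>

lemma aw_n_pt_eq_weight:
  assumes g: "g meromorphic_on UNIV" and p: "p \<noteq> 0" "p\<^sup>2 \<noteq> 1"
    and "(aw_z x)\<^sup>2 \<noteq> 1" "(p * aw_z x)\<^sup>2 \<noteq> 1" "(p\<^sup>2 * aw_z x)\<^sup>2 \<noteq> 1"
  shows "aw_n_pt p g x = aw_weight p g (p * aw_z x)"
  using nu0_AW_min(2)[OF g p, of "p * aw_z x"] assms(2,4-6)
  by (simp add: aw_n_pt_def aw_weight_def aw_z_props(2) eta_k_conv_joukowski(1)[OF p(1)]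
      power2_eq_square mult.assoc)

subsection \<open>Integrated counting functions as finite sums\<close>

text \<open>The kernel of the integrated counting functions as finite sums. At the origin it is \<open>ln r\<close>,
  which accounts for the separate term \<open>n(0) log r\<close>.\<close>

definition log_kernel :: "real \<Rightarrow> complex \<Rightarrow> real" where
  "log_kernel r x = (if x = 0 then ln r else if cmod x < r then ln (r / cmod x) else 0)"

text \<open>\<open>P\<close> stands for a < t or a \<le> t, which differ at one point only; the open
  discs of \<open>disc_count\<close> and the closed discs of \<open>pole_count\<close> are thus
  treated alike.\<close>

lemma has_integral_inverse_tail:
  fixes a r :: real
  assumes "0 < a" and P: "\<And>t. a < t \<Longrightarrow> P t" "\<And>t. P t \<Longrightarrow> a \<le> t"
  shows "((\<lambda>t. if P t then 1 / t else 0) has_integral (if a < r then ln (r / a) else 0)) {0..r}"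
proof (cases "a < r")
  case True
  have "((\<lambda>t. 1 / t) has_integral ln r - ln a) {a..r}"
    using assms(1) True
    by (intro fundamental_theorem_of_calculus)
       (auto intro!: derivative_eq_intros simp flip: has_real_derivative_iff_has_vector_derivative)
  also have "ln r - ln a = ln (r / a)" using assms(1) True by (simp add: ln_div)
  finally have "((\<lambda>t. if t \<in> {a..r} then 1 / t else 0) has_integral ln (r / a)) {0..r}"
    using assms(1) by (subst has_integral_restrict) auto
  hence "((\<lambda>t. if P t then 1 / t else 0) has_integral ln (r / a)) {0..r}"
    by (rule has_integral_spike_finite[of "{a}", rotated 2])
       (use P in \<open>auto simp: not_le dest: order.antisym, force+\<close>)
  thus ?thesis using True by simp
next
  case False
  have "((\<lambda>t. if P t then 1 / t else 0) has_integral 0) {0..r}"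
  proof (rule has_integral_spike_finite[of "{r}" _ _ "\<lambda>_. 0"])
    fix t assume "t \<in> {0..r} - {r}"
    with P(2)[of t] False show "(if P t then 1 / t else 0) = 0" by auto
  qed auto
  thus ?thesis using False by simp
qed

lemma integral_step_count:
  assumes "finite S" and P: "\<And>x t. cmod x < t \<Longrightarrow> P x t" "\<And>x t. P x t \<Longrightarrow> cmod x \<le> t"
    and c: "\<And>t. t \<in> {0..r} \<Longrightarrow> c t = (\<Sum>x\<in>{x\<in>S. x \<noteq> 0 \<and> P x t}. w x)"
    and w0: "0 \<notin> S \<Longrightarrow> w 0 = 0"
  shows "integral {0..r} (\<lambda>t. c t / t) + w 0 * ln r = (\<Sum>x\<in>S. w x * log_kernel r x)"
proof -
  let ?S = "S - {0}"
  have "((\<lambda>t. \<Sum>x\<in>?S. w x * (if P x t then 1 / t else 0)) has_integral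
      (\<Sum>x\<in>?S. w x * (if cmod x < r then ln (r / cmod x) else 0))) {0..r}"
    using assms(1) P
    by (intro has_integral_sum has_integral_mult_right has_integral_inverse_tail) auto
  also have "?this \<longleftrightarrow> ((\<lambda>t. c t / t) has_integral
      (\<Sum>x\<in>?S. w x * (if cmod x < r then ln (r / cmod x) else 0))) {0..r}"
  proof (rule has_integral_cong)
    fix t assume "t \<in> {0..r}"
    hence "c t / t = (\<Sum>x\<in>{x\<in>S. x \<noteq> 0 \<and> P x t}. w x * (1 / t))"
      using c by (simp add: sum_divide_distrib)
    also have "\<dots> = (\<Sum>x\<in>?S. w x * (if P x t then 1 / t else 0))"
      using assms(1) by (intro sum.mono_neutral_cong_left) auto
    finally show "(\<Sum>x\<in>?S. w x * (if P x t then 1 / t else 0)) = c t / t" by simp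
  qed
  finally have "integral {0..r} (\<lambda>t. c t / t) =
      (\<Sum>x\<in>?S. w x * (if cmod x < r then ln (r / cmod x) else 0))"
    by (rule integral_unique)
  also have "\<dots> = (\<Sum>x\<in>?S. w x * log_kernel r x)"
    by (intro sum.cong) (auto simp: log_kernel_def)
  also have "\<dots> + w 0 * ln r = (\<Sum>x\<in>S. w x * log_kernel r x)"
  proof (cases "0 \<in> S")
    case True
    thus ?thesis using assms(1) by (subst sum.remove[of S 0]) (auto simp: log_kernel_def)
  qed (use w0 in auto)
  finally show ?thesis .
qed

text \<open>Extra points of \<open>S\<close> contribute nothing, since either the weight or the
  kernel vanishes there; so several counting functions can be expanded over one index set.\<close>

lemma int_count_eq_sum:
  assumes S: "finite S" "{x\<in>ball 0 r. h x \<noteq> 0} \<subseteq> S" and r: "0 < r"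
  shows "int_count h r = (\<Sum>x\<in>S. h x * log_kernel r x)"
proof -
  let ?S = "{x\<in>ball 0 r. h x \<noteq> 0}"
  have fin: "finite ?S" using S by (rule finite_subset[rotated])
  \<comment> \<open>At t = 0 the open disc is empty and the numerator would be - h 0 instead of an
    empty sum. Setting it to 0 is harmless because division by 0 gives 0.\<close>
  have "integral {0..r} (\<lambda>t. (if t = 0 then 0 else disc_count h t - h 0) / t) + h 0 * ln r = (\<Sum>x\<in>?S. h x * log_kernel r x)"
  proof (rule integral_step_count[where P = "\<lambda>x t. cmod x < t"])
    fix t assume t: "t \<in> {0..r}"
    show "(if t = 0 then 0 else disc_count h t - h 0) = sum h {x \<in> ?S. x \<noteq> 0 \<and> cmod x < t}"
    proof (cases "t = 0")
      case False
      have fin': "finite {x \<in> ball 0 t. h x \<noteq> 0}"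
        by (rule finite_subset[OF _ fin]) (use t in auto)
      have "disc_count h t = sum h ({x \<in> ball 0 t. h x \<noteq> 0} \<union> {0})"
        unfolding disc_count_def using fin' t False by (intro sum.mono_neutral_left) auto
      also have "\<dots> = h 0 + sum h ({x \<in> ball 0 t. h x \<noteq> 0} \<union> {0} - {0})"
        using fin' by (subst sum.remove[of _ 0]) auto
      also have "{x \<in> ball 0 t. h x \<noteq> 0} \<union> {0} - {0} = {x \<in> ?S. x \<noteq> 0 \<and> cmod x < t}"
        using t by auto
      finally show ?thesis using False by simp
    qed (auto intro!: sum.neutral)
  qed (use fin r in auto)
  also have "integral {0..r} (\<lambda>t. (if t = 0 then 0 else disc_count h t - h 0) / t)
      = integral {0..r} (\<lambda>t. (disc_count h t - h 0) / t)"
    by (intro integral_cong) auto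
  also have "(\<Sum>x\<in>?S. h x * log_kernel r x) = (\<Sum>x\<in>S. h x * log_kernel r x)"
    using S r by (intro sum.mono_neutral_left) (auto simp: log_kernel_def)
  finally show ?thesis by (simp add: int_count_def)
qed

lemma nev_N_eq_sum:
  fixes f :: "complex \<Rightarrow> complex"
  defines "w \<equiv> \<lambda>x. if is_pole f x then real (nat (- zorder f x)) else 0"
  assumes S: "finite S" "{x\<in>cball 0 r. is_pole f x} \<subseteq> S" and r: "0 < r"
  shows "nev_N f r = (\<Sum>x\<in>S. w x * log_kernel r x)"
proof -
  let ?S = "{x\<in>cball 0 r. is_pole f x}"
  have fin: "finite ?S" using S by (rule finite_subset[rotated])
  have pc: "pole_count f t = sum w {x\<in>cball 0 t. is_pole f x}" for t
    unfolding pole_count_def w_def by (intro sum.cong) auto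
  have "{x\<in>cball 0 0. is_pole f x} = (if is_pole f 0 then {0} else {})" by auto
  hence p0: "pole_count f 0 = w 0" unfolding pc by (simp add: w_def)
  have "integral {0..r} (\<lambda>t. (pole_count f t - w 0) / t) + w 0 * ln r = (\<Sum>x\<in>?S. w x * log_kernel r x)"
  proof (rule integral_step_count[where P = "\<lambda>x t. cmod x \<le> t"])
    fix t assume t: "t \<in> {0..r}"
    have fin': "finite {x \<in> cball 0 t. is_pole f x}"
      by (rule finite_subset[OF _ fin]) (use t in auto)
    have "pole_count f t = sum w ({x \<in> cball 0 t. is_pole f x} \<union> {0})"
      unfolding pc using fin' t by (intro sum.mono_neutral_left) (auto simp: w_def)
    also have "\<dots> = w 0 + sum w ({x \<in> cball 0 t. is_pole f x} \<union> {0} - {0})"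
      using fin' by (subst sum.remove[of _ 0]) auto
    also have "{x \<in> cball 0 t. is_pole f x} \<union> {0} - {0} = {x \<in> ?S. x \<noteq> 0 \<and> cmod x \<le> t}"
      using t by auto
    finally show "pole_count f t - w 0 = sum w {x \<in> ?S. x \<noteq> 0 \<and> cmod x \<le> t}" by simp
  qed (use fin r in \<open>auto simp: w_def\<close>)
  also have "(\<Sum>x\<in>?S. w x * log_kernel r x) = (\<Sum>x\<in>S. w x * log_kernel r x)"
    using S r by (intro sum.mono_neutral_left) (auto simp: w_def log_kernel_def split: if_splits)
  finally show ?thesis by (simp add: nev_N_def p0)
qed

section \<open>Kernel estimates and comparison of counting functions\<close>

lemma log_kernel_nonneg: "1 \<le> r \<Longrightarrow> 0 \<le> log_kernel r x"
  by (auto simp: log_kernel_def)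

lemma log_kernel_mono:
  assumes "0 < r" "r \<le> s"
  shows "log_kernel r x \<le> log_kernel s x"
  using assms by (auto simp: log_kernel_def divide_simps)

lemma abs_log_kernel_le:
  assumes "1 \<le> r"
  shows "\<bar>log_kernel r x\<bar> \<le> ln r + \<bar>ln (cmod x)\<bar>"
  using assms by (auto simp: log_kernel_def ln_div)

text \<open>Away from the origin the kernel is max(0, ln r - ln |x|), a 1-Lipschitz function of ln
  |x|, so crossing the circle |x| = r costs nothing extra.\<close>

lemma abs_log_kernel_diff_le:
  assumes "x \<noteq> 0" "y \<noteq> 0" "cmod x \<le> \<kappa> * cmod y" "cmod y \<le> \<kappa> * cmod x" "0 < r"
  shows "\<bar>log_kernel r x - log_kernel r y\<bar> \<le> ln \<kappa>"
proof -
  have k: "\<kappa> > 0" using assms by (metis mult_nonpos_nonneg norm_ge_zero norm_le_zero_iff not_less order_trans)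
  have "ln (cmod x) \<le> ln (\<kappa> * cmod y)" "ln (cmod y) \<le> ln (\<kappa> * cmod x)"
    using assms by (subst ln_le_cancel_iff; simp add: k)+
  hence *: "ln (cmod x) \<le> ln \<kappa> + ln (cmod y)" "ln (cmod y) \<le> ln \<kappa> + ln (cmod x)"
    using assms k by (simp_all add: ln_mult)
  have e: "log_kernel r u = max 0 (ln r - ln (cmod u))" if "u \<noteq> 0" for u
    using that assms(5) by (auto simp: log_kernel_def ln_div max_def)
  show ?thesis unfolding e[OF assms(1)] e[OF assms(2)] using * by linarith
qed

text \<open>One constant serves all subsets \<open>T\<close>, since the leftover points to be
  estimated vary with r inside a fixed finite set.\<close>

lemma finite_sum_abs_log_kernel_le:
  assumes "finite Q"
  obtains C where "\<And>r T. exp 1 \<le> r \<Longrightarrow> T \<subseteq> Q \<Longrightarrow> \<bar>\<Sum>x\<in>T. h x * log_kernel r x\<bar> \<le> C * ln r"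
proof -
  define C where "C = (\<Sum>x\<in>Q. \<bar>h x\<bar> * (1 + \<bar>ln (cmod x)\<bar>))"
  have "\<bar>\<Sum>x\<in>T. h x * log_kernel r x\<bar> \<le> C * ln r" if r: "exp 1 \<le> r" and T: "T \<subseteq> Q" for r T
  proof -
    have r1: "1 \<le> r" using r one_le_exp_iff[of "1::real"] by linarith
    hence l: "1 \<le> ln r" using r by (subst ln_ge_iff) auto
    have "\<bar>\<Sum>x\<in>T. h x * log_kernel r x\<bar> \<le> (\<Sum>x\<in>T. \<bar>h x * log_kernel r x\<bar>)" by (rule sum_abs)
    also have "\<dots> \<le> (\<Sum>x\<in>Q. \<bar>h x * log_kernel r x\<bar>)"
      using T assms by (intro sum_mono2) auto
    also have "\<dots> \<le> (\<Sum>x\<in>Q. \<bar>h x\<bar> * (1 + \<bar>ln (cmod x)\<bar>) * ln r)"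
    proof (rule sum_mono)
      fix x
      have "\<bar>log_kernel r x\<bar> \<le> ln r + \<bar>ln (cmod x)\<bar>" by (rule abs_log_kernel_le[OF r1])
      also have "\<dots> \<le> ln r + \<bar>ln (cmod x)\<bar> * ln r" using l by (simp add: mult_le_cancel_left1)
      finally have "\<bar>h x\<bar> * \<bar>log_kernel r x\<bar> \<le> \<bar>h x\<bar> * (ln r + \<bar>ln (cmod x)\<bar> * ln r)"
        by (intro mult_left_mono) auto
      thus "\<bar>h x * log_kernel r x\<bar> \<le> \<bar>h x\<bar> * (1 + \<bar>ln (cmod x)\<bar>) * ln r"
        by (simp add: abs_mult algebra_simps)
    qed
    finally show ?thesis by (simp add: C_def sum_distrib_right)
  qed
  thus ?thesis by (rule that)
qed

text \<open>Far out, \<open>\<phi>\<close> matches the points of \<open>h\<close> with those of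
  \<open>h1\<close>. Unmatched points lie in fixed discs and cost O(log r); a matched pair changes
  the kernel by at most ln \<kappa>, with weight h \<le> n.\<close>

lemma int_count_transport:
  fixes h h1 n :: "complex \<Rightarrow> real" and \<phi> :: "complex \<Rightarrow> complex"
  assumes fin: "\<And>R. finite {x\<in>ball 0 R. n x \<noteq> 0}" "\<And>R. finite {x\<in>ball 0 R. h1 x \<noteq> 0}"
    and h: "\<And>x. 0 \<le> h x" "\<And>x. h x \<le> n x"
    and \<phi>: "inj_on \<phi> {x. R1 < cmod x}" "\<And>x. R0 < cmod x \<Longrightarrow> x \<in> \<phi> ` {x. R1 < cmod x}"
    and h1: "\<And>x. R1 < cmod x \<Longrightarrow> h1 (\<phi> x) = h x"
    and \<kappa>: "1 \<le> \<kappa>" "\<And>x. R1 < cmod x \<Longrightarrow> cmod (\<phi> x) \<le> \<kappa> * cmod x"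
       "\<And>x. R1 < cmod x \<Longrightarrow> cmod x \<le> \<kappa> * cmod (\<phi> x)" and R1: "0 \<le> R1"
  shows "\<exists>C. \<forall>r\<ge>exp 1. \<bar>int_count h1 r - int_count h r\<bar> \<le> C * ln r + ln \<kappa> * disc_count n (\<kappa> * r)"
proof -
  define A where "A = {x. R1 < cmod x}"
  have hn: "n x \<noteq> 0" if "h x \<noteq> 0" for x using h[of x] that by linarith
  have finh: "finite {x\<in>ball 0 R. h x \<noteq> 0}" for R
    by (rule finite_subset[OF _ fin(1)[of R]]) (use hn in auto)
  \<comment> \<open>Open balls containing the closed discs of radius R0 and R1, in which all
    unmatched points lie.\<close>
  define Q1 Q where "Q1 = {x\<in>ball 0 (R0 + 1). h1 x \<noteq> 0}" "Q = {x\<in>ball 0 (R1 + 1). h x \<noteq> 0}"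
  have "finite Q1" "finite Q" unfolding Q1_Q_def using fin(2) finh by auto
  obtain C1 where C1: "\<And>r T. exp 1 \<le> r \<Longrightarrow> T \<subseteq> Q1 \<Longrightarrow> \<bar>\<Sum>x\<in>T. h1 x * log_kernel r x\<bar> \<le> C1 * ln r"
    using finite_sum_abs_log_kernel_le[OF \<open>finite Q1\<close>, of h1] by blast
  obtain C2 where C2: "\<And>r T. exp 1 \<le> r \<Longrightarrow> T \<subseteq> Q \<Longrightarrow> \<bar>\<Sum>x\<in>T. h x * log_kernel r x\<bar> \<le> C2 * ln r"
    using finite_sum_abs_log_kernel_le[OF \<open>finite Q\<close>, of h] by blast
  have "\<bar>int_count h1 r - int_count h r\<bar> \<le> (C1 + C2) * ln r + ln \<kappa> * disc_count n (\<kappa> * r)"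
    if r: "exp 1 \<le> r" for r
  proof -
    have r0: "0 < r" using r by (rule less_le_trans[rotated]) auto
    have kr: "r \<le> \<kappa> * r" using r0 \<kappa>(1) by simp
    \<comment> \<open>Radius \<kappa> r captures the points of \<open>h\<close> in the disc of
      radius r as well as the matched points whose image lies in that disc.\<close>
    define S where "S = {x\<in>ball 0 (\<kappa> * r). h x \<noteq> 0}"
    have S: "finite S" unfolding S_def by (rule finh)
    define S1 where "S1 = {x\<in>ball 0 r. h1 x \<noteq> 0} - \<phi> ` A"
    have S1: "finite S1" using fin(2)[of r] by (simp add: S1_def)
    have S1Q: "S1 \<subseteq> Q1"
    proof
      fix x assume x: "x \<in> S1"
      hence "\<not> R0 < cmod x" using \<phi>(2)[of x] unfolding S1_def A_def by blast
      with x show "x \<in> Q1" by (simp add: S1_def Q1_Q_def)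
    qed
    have inj: "inj_on \<phi> (S \<inter> A)" using \<phi>(1) by (rule inj_on_subset) (auto simp: A_def)
    have "int_count h1 r = (\<Sum>x\<in>S1 \<union> \<phi> ` (S \<inter> A). h1 x * log_kernel r x)"
    proof (rule int_count_eq_sum)
      show "finite (S1 \<union> \<phi> ` (S \<inter> A))" using S S1 by auto
      show "{x \<in> ball 0 r. h1 x \<noteq> 0} \<subseteq> S1 \<union> \<phi> ` (S \<inter> A)"
      proof
        fix x assume x: "x \<in> {x \<in> ball 0 r. h1 x \<noteq> 0}"
        show "x \<in> S1 \<union> \<phi> ` (S \<inter> A)"
        proof (cases "x \<in> \<phi> ` A")
          case True
          then obtain y where y: "y \<in> A" "x = \<phi> y" by auto
          have "cmod y \<le> \<kappa> * cmod x" using \<kappa>(3)[of y] y by (simp add: A_def)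
          also have "\<dots> < \<kappa> * r" using x \<kappa>(1) by simp
          finally have "y \<in> S" using x y h1[of y] by (auto simp: S_def A_def)
          with y show ?thesis by auto
        qed (use x in \<open>auto simp: S1_def\<close>)
      qed
    qed (use r0 in auto)
    also have "\<dots> = (\<Sum>x\<in>S1. h1 x * log_kernel r x) + (\<Sum>x\<in>\<phi> ` (S \<inter> A). h1 x * log_kernel r x)"
      using S S1 by (intro sum.union_disjoint) (auto simp: S1_def)
    also have "(\<Sum>x\<in>\<phi> ` (S \<inter> A). h1 x * log_kernel r x) = (\<Sum>x\<in>S \<inter> A. h x * log_kernel r (\<phi> x))"
      using h1 by (subst sum.reindex[OF inj]) (auto simp: A_def intro!: sum.cong)
    finally have e1: "int_count h1 r = (\<Sum>x\<in>S1. h1 x * log_kernel r x) + (\<Sum>x\<in>S \<inter> A. h x * log_kernel r (\<phi> x))" .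
    have "int_count h r = (\<Sum>x\<in>S. h x * log_kernel r x)"
      by (rule int_count_eq_sum[OF S _ r0]) (use kr in \<open>auto simp: S_def\<close>)
    also have "\<dots> = (\<Sum>x\<in>S - A. h x * log_kernel r x) + (\<Sum>x\<in>S \<inter> A. h x * log_kernel r x)"
      using sum.Int_Diff[OF S, of "\<lambda>x. h x * log_kernel r x" A] by simp
    finally have e2: "int_count h r = (\<Sum>x\<in>S - A. h x * log_kernel r x) + (\<Sum>x\<in>S \<inter> A. h x * log_kernel r x)" .
    have "\<bar>(\<Sum>x\<in>S \<inter> A. h x * log_kernel r (\<phi> x)) - (\<Sum>x\<in>S \<inter> A. h x * log_kernel r x)\<bar>
       = \<bar>\<Sum>x\<in>S \<inter> A. h x * (log_kernel r (\<phi> x) - log_kernel r x)\<bar>"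
      by (simp add: sum_subtractf right_diff_distrib)
    also have "\<dots> \<le> (\<Sum>x\<in>S \<inter> A. \<bar>h x * (log_kernel r (\<phi> x) - log_kernel r x)\<bar>)" by (rule sum_abs)
    also have "\<dots> \<le> (\<Sum>x\<in>S \<inter> A. n x * ln \<kappa>)"
    proof (rule sum_mono)
      fix x assume x: "x \<in> S \<inter> A"
      hence xA: "R1 < cmod x" by (simp add: A_def)
      hence "x \<noteq> 0" using R1 by auto
      moreover have "\<phi> x \<noteq> 0" using \<kappa>(3)[OF xA] xA R1 by auto
      ultimately have "\<bar>log_kernel r (\<phi> x) - log_kernel r x\<bar> \<le> ln \<kappa>"
        using \<kappa>(2,3)[OF xA] r0 by (intro abs_log_kernel_diff_le) auto
      thus "\<bar>h x * (log_kernel r (\<phi> x) - log_kernel r x)\<bar> \<le> n x * ln \<kappa>"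
        using h(1)[of x] h(2)[of x] by (auto simp: abs_mult intro!: mult_mono)
    qed
    also have "\<dots> \<le> (\<Sum>x\<in>{x\<in>ball 0 (\<kappa> * r). n x \<noteq> 0}. n x * ln \<kappa>)"
    proof (rule sum_mono2)
      show "S \<inter> A \<subseteq> {x\<in>ball 0 (\<kappa> * r). n x \<noteq> 0}"
        using hn by (auto simp: S_def)
      fix x
      have "0 \<le> n x" using h(1)[of x] h(2)[of x] by linarith
      thus "0 \<le> n x * ln \<kappa>" using \<kappa>(1) by simp
    qed (rule fin(1))
    also have "\<dots> = ln \<kappa> * disc_count n (\<kappa> * r)"
      by (simp add: disc_count_def sum_distrib_left mult.commute)
    finally have e3: "\<bar>(\<Sum>x\<in>S \<inter> A. h x * log_kernel r (\<phi> x)) - (\<Sum>x\<in>S \<inter> A. h x * log_kernel r x)\<bar>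
        \<le> ln \<kappa> * disc_count n (\<kappa> * r)" .
    have e4: "\<bar>\<Sum>x\<in>S1. h1 x * log_kernel r x\<bar> \<le> C1 * ln r" by (rule C1[OF r S1Q])
    have e5: "\<bar>\<Sum>x\<in>S - A. h x * log_kernel r x\<bar> \<le> C2 * ln r"
      by (rule C2[OF r]) (auto simp: S_def A_def Q1_Q_def)
    show ?thesis unfolding e1 e2 using e3 e4 e5 by (simp add: distrib_right)
  qed
  thus ?thesis by blast
qed

text \<open>For s = r (ln r)^2 and 0 < |x| < \<kappa> r one has s/|x| > (ln r)^2/\<kappa> \<ge> ln
  r: one factor ln r absorbs \<kappa>, the other yields ln (ln r).\<close>

lemma disc_count_le_int_count:
  assumes fin: "\<And>R. finite {x\<in>ball 0 R. n x \<noteq> 0}" and n: "\<And>x. 0 \<le> n x"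
    and \<kappa>: "1 \<le> \<kappa>" and r: "exp 1 < r" "\<kappa> \<le> ln r"
  shows "ln (ln r) * disc_count n (\<kappa> * r) \<le> int_count n (r * (ln r)\<^sup>2)"
proof -
  have r0: "0 < r" using r(1) by (rule less_trans[rotated]) auto
  have l: "1 < ln r" using r r0 by (metis exp_less_cancel_iff exp_ln)
  have l2: "1 \<le> (ln r)\<^sup>2" using l by simp
  have r1: "1 \<le> r" using r(1) one_le_exp_iff[of "1::real"] by linarith
  define s where "s = r * (ln r)\<^sup>2"
  have "1 * r \<le> s" unfolding s_def mult.commute[of r] using l2 r0 by (intro mult_right_mono) auto
  hence rs: "r \<le> s" by simp
  have ks: "\<kappa> * r * ln r \<le> s"
    unfolding s_def power2_eq_square using r(2) r0 r1 l mult_right_mono[OF r(2), of "ln r"]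
    by (simp add: mult_ac)
  define S where "S = {x\<in>ball 0 (\<kappa> * r). n x \<noteq> 0}"
  have S: "finite S" "finite {x\<in>ball 0 s. n x \<noteq> 0}" unfolding S_def using fin by blast+
  have "\<kappa> * r * 1 \<le> \<kappa> * r * ln r" using l \<kappa> r0 by (intro mult_left_mono) auto
  hence krs: "\<kappa> * r \<le> s" using ks by linarith
  have "ln (ln r) * disc_count n (\<kappa> * r) = (\<Sum>x\<in>S. n x * ln (ln r))"
    by (simp add: disc_count_def S_def sum_distrib_left mult.commute)
  also have "\<dots> \<le> (\<Sum>x\<in>S. n x * log_kernel s x)"
  proof (intro sum_mono mult_left_mono n)
    fix x assume x: "x \<in> S"
    show "ln (ln r) \<le> log_kernel s x"
    proof (cases "x = 0")
      case True
      have "ln r \<le> s" using rs ln_le_minus_one[OF r0] by linarith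
      moreover have "1 < r" using l ln_gt_zero_iff[of r] r0 by linarith
      ultimately have "ln (ln r) \<le> ln s" using l rs r0 by (subst ln_le_cancel_iff) auto
      thus ?thesis using True by (simp add: log_kernel_def)
    next
      case False
      have "cmod x < \<kappa> * r" using x by (simp add: S_def)
      hence lt: "cmod x < s" using krs by linarith
      have "ln r * cmod x \<le> ln r * (\<kappa> * r)"
        using l \<open>cmod x < \<kappa> * r\<close> by (intro mult_left_mono) auto
      also have "\<dots> \<le> s" using ks by (simp add: mult_ac)
      finally have "ln r \<le> s / cmod x" using False by (simp add: field_simps)
      hence "ln (ln r) \<le> ln (s / cmod x)" using l by simp
      thus ?thesis using False lt by (simp add: log_kernel_def)
    qed
  qed
  also have "\<dots> \<le> (\<Sum>x\<in>{x\<in>ball 0 s. n x \<noteq> 0}. n x * log_kernel s x)"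
    using krs r1 rs n by (intro sum_mono2 S) (auto simp: S_def intro!: mult_nonneg_nonneg log_kernel_nonneg)
  also have "\<dots> = int_count n s"
    using r0 rs by (intro int_count_eq_sum[symmetric] S) auto
  finally show ?thesis by (simp add: s_def)
qed

lemma int_count_mono:
  assumes fin: "\<And>R. finite {x\<in>ball 0 R. n x \<noteq> 0}" and n: "\<And>x. 0 \<le> n x" and "0 < r" "r \<le> s"
  shows "int_count n r \<le> int_count n s"
proof -
  let ?S = "{x\<in>ball 0 s. n x \<noteq> 0}"
  have "int_count n r = (\<Sum>x\<in>?S. n x * log_kernel r x)"
    by (rule int_count_eq_sum) (use assms in auto)
  also have "\<dots> \<le> (\<Sum>x\<in>?S. n x * log_kernel s x)"
    by (intro sum_mono mult_left_mono log_kernel_mono assms n)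
  also have "\<dots> = int_count n s"
    by (rule int_count_eq_sum[symmetric]) (use assms in auto)
  finally show ?thesis .
qed

lemma int_count_nonneg:
  assumes fin: "\<And>R. finite {x\<in>ball 0 R. n x \<noteq> 0}" and n: "\<And>x. 0 \<le> n x" and "1 \<le> r"
  shows "0 \<le> int_count n r"
proof -
  have "int_count n r = (\<Sum>x\<in>{x\<in>ball 0 r. n x \<noteq> 0}. n x * log_kernel r x)"
    by (rule int_count_eq_sum) (use assms in auto)
  also have "\<dots> \<ge> 0" using assms by (intro sum_nonneg mult_nonneg_nonneg log_kernel_nonneg n)
  finally show ?thesis .
qed

subsection \<open>A Borel growth lemma\<close>

text \<open>In the application \<open>\<beta> k\<close> is the logarithm of the growth function at a
  grid point, and 1/k is comparable to the length of a grid step in dt/(t ln t).\<close>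

lemma summable_second_difference_div:
  fixes \<beta> :: "nat \<Rightarrow> real"
  assumes \<beta>: "\<And>k. 0 \<le> \<beta> k" and bound: "\<And>k. k \<ge> k0 \<Longrightarrow> \<beta> k \<le> real k powr s" and s: "s < 1"
  shows "summable (\<lambda>k. (\<beta> (k + 2) - \<beta> k) / real k)"
proof -
  txt \<open>Summation by parts.\<close>
  define b where "b = (\<lambda>k. \<beta> k / real k)"
  have blim: "b \<longlonglongrightarrow> 0"
  proof (rule tendsto_sandwich[OF _ _ tendsto_const])
    show "\<forall>\<^sub>F k in sequentially. 0 \<le> b k" using \<beta> by (simp add: b_def)
    show "\<forall>\<^sub>F k in sequentially. b k \<le> real k powr (s - 1)"
      using eventually_ge_at_top[of "max 1 k0"]
    proof eventually_elim
      case (elim k)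
      thus ?case using bound[of k] by (simp add: b_def powr_diff divide_right_mono)
    qed
    show "(\<lambda>k. real k powr (s - 1)) \<longlonglongrightarrow> 0"
      using s by (intro tendsto_neg_powr filterlim_real_sequentially) auto
  qed
  have "summable (\<lambda>k. b (Suc k) - b k)" using blim by (rule telescope_summable)
  hence "summable (\<lambda>k. (b (Suc (Suc k)) - b (Suc k)) + (b (Suc k) - b k))"
    by (intro summable_add) (simp add: summable_Suc_iff[of "\<lambda>k. b (Suc k) - b k"])
  hence 1: "summable (\<lambda>k. b (k + 2) - b k)" by simp
  \<comment> \<open>The remainder after telescoping comes from 1/k - 1/(k + 2) = 2/(k (k + 2)) and
    is O(k^(s - 2)).\<close>
  have 2: "summable (\<lambda>k. 2 * \<beta> (k + 2) / (real k * real (k + 2)))"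
  proof (rule summable_comparison_test_ev)
    have "summable (\<lambda>k. real k powr (s - 2))"
      using s by (subst summable_real_powr_iff) auto
    thus "summable (\<lambda>k. 6 * real (k + 2) powr (s - 2))"
      by (intro summable_mult) (subst summable_iff_shift[of "\<lambda>k. real k powr (s - 2)"])
    show "\<forall>\<^sub>F k in sequentially. norm (2 * \<beta> (k + 2) / (real k * real (k + 2)))
        \<le> 6 * real (k + 2) powr (s - 2)"
      using eventually_ge_at_top[of "max 1 k0"]
    proof eventually_elim
      case (elim k)
      have "norm (2 * \<beta> (k + 2) / (real k * real (k + 2))) = 2 * \<beta> (k + 2) / (real k * real (k + 2))"
        using \<beta> by simp
      \<comment> \<open>k \<ge> (k + 2)/3 for k \<ge> 1, whence the constant 6.\<close>
      also have "\<dots> \<le> 2 * \<beta> (k + 2) / (real (k + 2) / 3 * real (k + 2))"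
        using elim \<beta> by (intro divide_left_mono mult_right_mono) auto
      also have "\<dots> = 6 * (\<beta> (k + 2) / real (k + 2) ^ 2)"
        by (simp add: power2_eq_square)
      also have "\<dots> \<le> 6 * (real (k + 2) powr s / real (k + 2) ^ 2)"
        using bound[of "k + 2"] elim by (intro mult_left_mono divide_right_mono) auto
      also have "real (k + 2) powr s / real (k + 2) ^ 2 = real (k + 2) powr (s - 2)"
        by (simp add: powr_diff powr_realpow)
      finally show ?case .
    qed
  qed
  have "summable (\<lambda>k. (b (k + 2) - b k) + 2 * \<beta> (k + 2) / (real k * real (k + 2)))"
    by (intro summable_add 1 2)
  moreover have "\<forall>\<^sub>F k in sequentially. (b (k + 2) - b k) + 2 * \<beta> (k + 2) / (real k * real (k + 2))
      = (\<beta> (k + 2) - \<beta> k) / real k"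
    using eventually_gt_at_top[of 0] by eventually_elim (simp add: b_def divide_simps, simp add: algebra_simps)
  ultimately show ?thesis using summable_cong by fast
qed

lemma nn_integral_ln_ln:
  assumes "1 < a" "a \<le> b"
  shows "(\<integral>\<^sup>+ t. indicator {a..b} t * ennreal (1 / (t * ln t)) \<partial>lborel) = ennreal (ln (ln b) - ln (ln a))"
proof -
  have "(\<integral>\<^sup>+ t. ennreal (1 / (t * ln t)) * indicator {a..b} t \<partial>lborel) = ennreal (ln (ln b) - ln (ln a))"
  proof (rule nn_integral_FTC_Icc)
    fix x assume "x \<in> {a..b}"
    thus "((\<lambda>t. ln (ln t)) has_real_derivative 1 / (x * ln x)) (at x)" "0 \<le> 1 / (x * ln x)"
      using assms by (auto intro!: derivative_eq_intros simp: field_simps)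
  qed (use assms in auto)
  thus ?thesis by (simp add: mult.commute)
qed

lemma borel_growth:
  fixes B :: "real \<Rightarrow> real"
  assumes mono: "\<And>r s. 1 \<le> r \<Longrightarrow> r \<le> s \<Longrightarrow> B r \<le> B s" and B1: "\<And>r. 1 \<le> r \<Longrightarrow> 1 \<le> B r"
    and \<sigma>: "0 < \<sigma>" "\<sigma> < 1" and bound: "\<And>r. r \<ge> r0 \<Longrightarrow> B r \<le> exp (ln r powr \<sigma>)"
  shows "\<exists>F R. F \<in> sets lborel \<and> F \<subseteq> {1<..} \<and>
           (\<integral>\<^sup>+ t. indicator F t * ennreal (1 / (t * ln t)) \<partial>lborel) < \<infinity> \<and>
           (\<forall>r. R < r \<and> r \<notin> F \<longrightarrow> B (r * (ln r)\<^sup>2) \<le> 2 * B r)"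
proof -
  txt \<open>The grid \<open>exp (k powr \<alpha>)\<close> is coarse enough (\<open>\<alpha> > 1\<close>) that two steps cover the factor \<open>(ln r)\<^sup>2\<close>,
    and fine enough (\<open>\<alpha> * \<sigma> < 1\<close>) that the steps on which \<open>B\<close> doubles have finite total measure.\<close>
  define \<alpha> where "\<alpha> = 2 / (1 + \<sigma>)"
  \<comment> \<open>\<open>\<alpha>\<close> is the harmonic mean of 1 and 1/\<sigma>, hence strictly
    between them.\<close>
  have \<alpha>: "1 < \<alpha>" "\<alpha> * \<sigma> < 1" using \<sigma> by (auto simp: \<alpha>_def field_simps)
  define v where "v = (\<lambda>k::nat. real k powr \<alpha>)"
  have vmono: "v k \<le> v l" if "k \<le> l" for k l
    using that \<alpha> by (auto simp: v_def intro!: powr_mono2)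
  have v0: "0 \<le> v k" for k by (simp add: v_def)
  have vlim: "filterlim v at_top sequentially"
  proof (rule filterlim_at_top_mono[OF filterlim_real_sequentially])
    show "\<forall>\<^sub>F k in sequentially. real k \<le> v k"
      using eventually_ge_at_top[of 1]
    proof eventually_elim
      case (elim k)
      thus ?case using powr_mono[of 1 \<alpha> "real k"] \<alpha> by (simp add: v_def)
    qed
  qed
  define \<beta> where "\<beta> = (\<lambda>k. ln (B (exp (v k))))"
  have Bpos: "1 \<le> B (exp (v k))" for k using B1 v0 by simp
  have \<beta>0: "0 \<le> \<beta> k" for k using Bpos[of k] by (simp add: \<beta>_def)
  have \<beta>mono: "\<beta> k \<le> \<beta> l" if "k \<le> l" for k l
    unfolding \<beta>_def using Bpos[of k] Bpos[of l] mono[of "exp (v k)" "exp (v l)"] vmono[OF that] v0 by simp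
  have "\<forall>\<^sub>F k in sequentially. ln r0 \<le> v k \<and> 0 < k"
    using vlim by (auto simp: filterlim_at_top eventually_conj_iff eventually_gt_at_top)
  then obtain k0 where k0: "\<And>k. k \<ge> k0 \<Longrightarrow> ln r0 \<le> v k"
    by (auto simp: eventually_at_top_linorder)
  have \<beta>bound: "\<beta> k \<le> real k powr (\<alpha> * \<sigma>)" if "k \<ge> k0" for k
  proof -
    have "r0 \<le> exp (v k)"
    proof (cases "r0 > 0")
      case True
      thus ?thesis using k0[OF that] by (metis exp_le_cancel_iff exp_ln)
    qed (use exp_gt_zero[of "v k"] in linarith)
    hence "B (exp (v k)) \<le> exp (v k powr \<sigma>)" using bound[of "exp (v k)"] by simp
    hence "\<beta> k \<le> ln (exp (v k powr \<sigma>))"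
      unfolding \<beta>_def using Bpos[of k] by (subst ln_le_cancel_iff) auto
    thus ?thesis by (simp add: v_def powr_powr)
  qed
  have sum: "summable (\<lambda>k. (\<beta> (k + 2) - \<beta> k) / real k)"
    by (rule summable_second_difference_div[OF \<beta>0 \<beta>bound \<alpha>(2)])
  have "(\<lambda>k. ln (real k) / real k powr (\<alpha> - 1)) \<longlonglongrightarrow> 0"
    using \<alpha> by (intro lim_ln_over_power) auto
  hence "\<forall>\<^sub>F k in sequentially. ln (real k) / real k powr (\<alpha> - 1) < 1 / (2 * \<alpha>)"
    by (rule order_tendstoD) (use \<alpha> in auto)
  then obtain k1 where k1: "\<And>k. k \<ge> k1 \<Longrightarrow> ln (real k) / real k powr (\<alpha> - 1) < 1 / (2 * \<alpha>)"
    by (auto simp: eventually_at_top_linorder)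
  \<comment> \<open>m \<ge> 1 makes v(k) positive for k \<ge> m, so the bad intervals lie beyond 1,
    and permits division by k.\<close>
  define m where "m = k1 + 1"
  \<comment> \<open>With x = k + 1, the next step of the grid is at least x^(\<alpha> - 1), which
    outgrows 2 ln (v (k + 1)) = 2 \<alpha> ln x. So exp (v (k + 1)) times v (k + 1)^2 stays below
    the next grid point.\<close>
  have gap: "v (k + 1) + 2 * ln (v (k + 1)) \<le> v (k + 2)" if k: "k \<ge> m" for k
  proof -
    define x where "x = real (k + 1)"
    have x: "x \<ge> 1" by (simp add: x_def)
    have "ln x / x powr (\<alpha> - 1) < 1 / (2 * \<alpha>)" unfolding x_def using k by (intro k1) (auto simp: m_def)
    hence "2 * \<alpha> * ln x \<le> x powr (\<alpha> - 1)" using \<alpha> x by (simp add: field_simps)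
    moreover have "v (k + 1) = x * x powr (\<alpha> - 1)"
      using x by (simp add: v_def x_def powr_mult_base)
    moreover have "(x + 1) * x powr (\<alpha> - 1) \<le> v (k + 2)"
    proof -
      have "(x + 1) * x powr (\<alpha> - 1) \<le> (x + 1) * (x + 1) powr (\<alpha> - 1)"
        using x \<alpha> by (intro mult_left_mono powr_mono2) auto
      also have "\<dots> = v (k + 2)" using x by (simp add: v_def x_def powr_mult_base add.commute)
      finally show ?thesis .
    qed
    moreover have "ln (v (k + 1)) = \<alpha> * ln x" using x by (simp add: v_def x_def ln_powr)
    ultimately show ?thesis by (simp add: distrib_right)
  qed
  \<comment> \<open>Two steps are compared because r lies in step k while r (ln r)^2 may reach into
    step k + 1.\<close>
  define K where "K = {k. k \<ge> m \<and> ln 2 < \<beta> (k + 2) - \<beta> k}"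
  define I where "I = (\<lambda>k. {exp (v k)..exp (v (k + 1))})"
  define F where "F = (\<Union>k\<in>K. I k)"
  have vpos: "0 < v k" if "k \<in> K" for k using that by (auto simp: v_def K_def m_def)
  define c where "c = (\<lambda>k. if k \<in> K then ln (v (k + 1)) - ln (v k) else 0)"
  have c0: "0 \<le> c k" for k
    using vmono[of k "k + 1"] vpos[of k] by (auto simp: c_def)
  have sc: "summable c"
  proof (rule summable_comparison_test)
    \<comment> \<open>Step k has measure \<alpha> ln (1 + 1/k) \<le> \<alpha>/k, and for k in
      \<open>K\<close> the increment of \<beta> divided by ln 2 exceeds 1.\<close>
    show "summable (\<lambda>k. \<alpha> / ln 2 * ((\<beta> (k + 2) - \<beta> k) / real k))" by (intro summable_mult sum)
    have "norm (c k) \<le> \<alpha> / ln 2 * ((\<beta> (k + 2) - \<beta> k) / real k)" for k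
    proof (cases "k \<in> K")
      case True
      hence k: "real k > 0" "ln 2 < \<beta> (k + 2) - \<beta> k" by (auto simp: K_def m_def)
      have "c k = \<alpha> * ln (1 + 1 / real k)"
      proof -
        have "c k = \<alpha> * (ln (real (k + 1)) - ln (real k))"
          using True k by (simp add: c_def v_def ln_powr right_diff_distrib)
        also have "ln (real (k + 1)) - ln (real k) = ln (real (k + 1) / real k)"
          using k by (subst ln_div) auto
        also have "real (k + 1) / real k = 1 + 1 / real k" using k by (simp add: field_simps)
        finally show ?thesis .
      qed
      also have "\<dots> \<le> \<alpha> * (1 / real k)"
        using \<alpha> k by (intro mult_left_mono ln_add_one_self_le_self) auto
      also have "\<dots> = \<alpha> / ln 2 * (ln 2 / real k)" by simp
      also have "\<dots> \<le> \<alpha> / ln 2 * ((\<beta> (k + 2) - \<beta> k) / real k)"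
        using \<alpha> k by (intro mult_left_mono divide_right_mono) auto
      finally show ?thesis using c0[of k] by simp
    next
      case False
      thus ?thesis using \<alpha> \<beta>mono[of k "k + 2"] by (simp add: c_def)
    qed
    thus "\<exists>N. \<forall>k\<ge>N. norm (c k) \<le> \<alpha> / ln 2 * ((\<beta> (k + 2) - \<beta> k) / real k)" by blast
  qed
  let ?g = "\<lambda>t::real. ennreal (1 / (t * ln t))"
  have "(\<integral>\<^sup>+ t. indicator F t * ?g t \<partial>lborel)
      \<le> (\<integral>\<^sup>+ t. (\<Sum>k. if k \<in> K then indicator (I k) t * ?g t else 0) \<partial>lborel)"
  proof (rule nn_integral_mono)
    fix t
    show "indicator F t * ?g t \<le> (\<Sum>k. if k \<in> K then indicator (I k) t * ?g t else 0)"
    proof (cases "t \<in> F")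
      case True
      then obtain k where k: "k \<in> K" "t \<in> I k" by (auto simp: F_def)
      have "indicator F t * ?g t = (\<Sum>j\<in>{k}. if j \<in> K then indicator (I j) t * ?g t else 0)"
        using True k by simp
      also have "\<dots> \<le> (\<Sum>k. if k \<in> K then indicator (I k) t * ?g t else 0)"
        by (rule sum_le_suminf) auto
      finally show ?thesis .
    qed auto
  qed
  also have "\<dots> = (\<Sum>k. \<integral>\<^sup>+ t. (if k \<in> K then indicator (I k) t * ?g t else 0) \<partial>lborel)"
  proof (rule nn_integral_suminf)
    show "(\<lambda>t. if k \<in> K then indicator (I k) t * ?g t else 0) \<in> borel_measurable lborel" for k
      by (cases "k \<in> K") (auto simp: I_def)
  qed
  also have "\<dots> = (\<Sum>k. ennreal (c k))"
  proof (rule suminf_cong)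
    fix k
    show "(\<integral>\<^sup>+ t. (if k \<in> K then indicator (I k) t * ?g t else 0) \<partial>lborel) = ennreal (c k)"
      using nn_integral_ln_ln[of "exp (v k)" "exp (v (k + 1))"] vpos[of k] vmono[of k "k + 1"]
      by (auto simp: c_def I_def)
  qed
  also have "\<dots> = ennreal (suminf c)" by (rule suminf_ennreal2[OF c0 sc])
  also have "\<dots> < \<infinity>" by simp
  finally have int: "(\<integral>\<^sup>+ t. indicator F t * ?g t \<partial>lborel) < \<infinity>" .
  have sub: "F \<subseteq> {1<..}"
  proof
    fix t assume "t \<in> F"
    then obtain k where "k \<in> K" "t \<in> I k" by (auto simp: F_def)
    thus "t \<in> {1<..}" using vpos[of k] by (auto simp: I_def intro: less_le_trans[of 1 "exp (v k)"])
  qed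
  have meas: "F \<in> sets lborel" unfolding F_def I_def by (intro sets.countable_UN'') auto
  have main: "B (r * (ln r)\<^sup>2) \<le> 2 * B r" if r: "exp (v m) < r" "r \<notin> F" for r
  proof -
    have rpos: "0 < r" using r(1) by (rule less_trans[rotated]) simp
    have lr: "v m < ln r" using r(1) rpos by (metis exp_less_cancel_iff exp_ln)
    hence l0: "0 < ln r" using v0[of m] by linarith
    define k where "k = nat \<lfloor>ln r powr (1 / \<alpha>)\<rfloor>"
    have "real k \<le> ln r powr (1 / \<alpha>)" "ln r powr (1 / \<alpha>) \<le> real (k + 1)"
      unfolding k_def by (simp_all add: of_nat_nat) linarith
    hence "real k powr \<alpha> \<le> (ln r powr (1 / \<alpha>)) powr \<alpha>" "(ln r powr (1 / \<alpha>)) powr \<alpha> \<le> real (k + 1) powr \<alpha>"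
      using \<alpha> by (auto intro!: powr_mono2)
    hence vk: "v k \<le> ln r" "ln r \<le> v (k + 1)"
      using \<alpha> l0 by (simp_all add: v_def powr_powr)
    have km: "m \<le> k"
    proof (rule ccontr)
      assume "\<not> m \<le> k"
      hence "v (k + 1) \<le> v m" by (intro vmono) auto
      with vk lr show False by linarith
    qed
    have rk: "exp (v k) \<le> r" "r \<le> exp (v (k + 1))"
      using vk rpos by (metis exp_le_cancel_iff exp_ln)+
    with r(2) have "k \<notin> K" by (auto simp: F_def I_def)
    hence "\<beta> (k + 2) \<le> ln 2 + \<beta> k" using km by (auto simp: K_def)
    also have "\<dots> = ln (2 * B (exp (v k)))" using Bpos[of k] by (simp add: \<beta>_def ln_mult)
    finally have BB: "B (exp (v (k + 2))) \<le> 2 * B (exp (v k))"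
      unfolding \<beta>_def using Bpos[of k] Bpos[of "k + 2"] by (subst (asm) ln_le_cancel_iff) auto
    have vk1: "0 < v (k + 1)" using l0 vk by linarith
    have "r * (ln r)\<^sup>2 \<le> exp (v (k + 1)) * (v (k + 1))\<^sup>2"
      using rk vk l0 by (intro mult_mono power_mono) auto
    also have "(v (k + 1))\<^sup>2 = exp (2 * ln (v (k + 1)))"
      using vk1 by (simp add: exp_double exp_ln)
    also have "exp (v (k + 1)) * \<dots> \<le> exp (v (k + 2))"
      using gap[OF km] by (simp flip: exp_add)
    finally have le: "r * (ln r)\<^sup>2 \<le> exp (v (k + 2))" .
    have r1: "1 \<le> r" using l0 rpos by simp
    have "B (r * (ln r)\<^sup>2) \<le> B (exp (v (k + 2)))"
    proof (cases "1 \<le> r * (ln r)\<^sup>2")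
      case True thus ?thesis by (intro mono le)
    next
      case False
      have "1 \<le> (ln r)\<^sup>2"
      proof -
        have "1 \<le> v m" using \<alpha> by (simp add: v_def m_def ge_one_powr_ge_zero)
        thus ?thesis using lr by simp
      qed
      hence "1 * 1 \<le> r * (ln r)\<^sup>2" using r1 by (intro mult_mono) auto
      with False show ?thesis by simp
    qed
    also note BB
    also have "B (exp (v k)) \<le> B r" using rk v0 by (intro mono) auto
    finally show ?thesis by simp
  qed
  show ?thesis by (intro exI[of _ F] exI[of _ "exp (v m)"]) (use meas sub int main in auto)
qed

subsection \<open>Jensen's formula\<close>

lemma finite_cosparse_ball:
  assumes "eventually P (cosparse (UNIV :: complex set))"
  shows "finite {x\<in>ball 0 R. \<not> P x}"
proof -
  have "{x. \<not> P x} sparse_in UNIV" using assms by (simp add: eventually_cosparse)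
  hence "\<not> x islimpt {x. \<not> P x}" for x by (simp add: sparse_in_open)
  hence "finite (cball 0 R \<inter> {x. \<not> P x})"
    by (intro finite_not_islimpt_in_compact) auto
  thus ?thesis by (rule finite_subset[rotated]) auto
qed

lemma ln_powi: "0 < x \<Longrightarrow> ln (x powi n) = of_int n * ln (x :: real)"
  by (cases n rule: int_cases2) (simp_all add: ln_realpow power_int_minus ln_inverse)

text \<open>A zero-free H on a disc is exp G with G holomorphic, and ln |H| = Re G; Cauchy's formula
  for G at the centre gives the mean.\<close>

lemma ln_cmod_mean_value:
  assumes H: "H analytic_on cball 0 r" "\<And>x. x \<in> cball 0 r \<Longrightarrow> H x \<noteq> 0" and r: "0 < r"
  shows "((\<lambda>\<theta>. ln (cmod (H (of_real r * cis \<theta>)))) has_integral 2 * pi * ln (cmod (H 0))) {0..2*pi}"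
proof -
  obtain U where U: "open U" "cball 0 r \<subseteq> U" "H holomorphic_on U"
    using H(1) by (auto simp: analytic_on_holomorphic)
  define V where "V = U \<inter> H -` (-{0})"
  have "open V" unfolding V_def
    by (rule continuous_open_preimage[OF holomorphic_on_imp_continuous_on[OF U(3)] U(1)]) auto
  moreover have "cball 0 r \<subseteq> V" using U H(2) by (auto simp: V_def)
  ultimately obtain e where e: "e > 0" "(\<Union>x\<in>cball 0 r. cball x e) \<subseteq> V"
    using compact_subset_open_imp_cball_epsilon_subset[of "cball 0 r" V] by (auto simp: UN_subset_iff)
  \<comment> \<open>The holomorphic logarithm is taken on an open disc, so the zero-free region has
    to contain one slightly larger than the closed disc.\<close>
  have sub: "ball 0 (r + e) \<subseteq> V"
  proof
    fix x :: complex assume x: "x \<in> ball 0 (r + e)"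
    show "x \<in> V"
    proof (cases "cmod x \<le> r")
      case True thus ?thesis using \<open>cball 0 r \<subseteq> V\<close> by auto
    next
      case False
      have x0: "x \<noteq> 0" using False r by (metis less_imp_le norm_zero)
      define y where "y = of_real (r / cmod x) * x"
      have ny: "cmod y = r" using False r x0 by (simp add: y_def norm_mult norm_divide)
      have "x - y = of_real (1 - r / cmod x) * x" by (simp add: y_def algebra_simps)
      hence "cmod (x - y) = (1 - r / cmod x) * cmod x"
        using False r x0 by (simp only: norm_mult norm_of_real) (simp add: field_simps)
      also have "\<dots> = cmod x - r" using False r x0 by (simp add: field_simps)
      finally have "dist y x \<le> e" using x by (simp add: dist_norm norm_minus_commute)
      hence "x \<in> (\<Union>x\<in>cball 0 r. cball x e)" using ny by (intro UN_I[of y]) auto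
      thus ?thesis using e(2) by blast
    qed
  qed
  obtain G where G: "G holomorphic_on ball 0 (r + e)" "\<And>x. x \<in> ball 0 (r + e) \<Longrightarrow> exp (G x) = H x"
  proof (rule holomorphic_logarithm_exists[of "ball 0 (r + e)" H 0])
    show "H holomorphic_on ball 0 (r + e)"
      using U(3) by (rule holomorphic_on_subset) (use sub in \<open>auto simp: V_def\<close>)
    show "H x \<noteq> 0" if "x \<in> ball 0 (r + e)" for x using that sub by (auto simp: V_def)
  qed (use r e in auto)
  have Re: "Re (G x) = ln (cmod (H x))" if "x \<in> ball 0 (r + e)" for x
    using G(2)[OF that] by (metis norm_exp_eq_Re ln_exp)
  have "G holomorphic_on cball 0 r" using G(1) by (rule holomorphic_on_subset) (use e in auto)
  hence "((\<lambda>u. G u / (u - 0)) has_contour_integral 2 * of_real pi * \<i> * G 0) (circlepath 0 r)"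
    using r by (intro Cauchy_integral_circlepath_simple) auto
  hence "((\<lambda>\<theta>. G (r * cis \<theta>) / (r * cis \<theta>) * r * \<i> * cis \<theta>) has_integral 2 * of_real pi * \<i> * G 0) {0..2*pi}"
    unfolding circlepath_def by (subst (asm) has_contour_integral_part_circlepath_iff) auto
  also have "(\<lambda>\<theta>. G (r * cis \<theta>) / (r * cis \<theta>) * r * \<i> * cis \<theta>) = (\<lambda>\<theta>. \<i> * G (r * cis \<theta>))"
    using r by (auto simp: fun_eq_iff)
  finally have "((\<lambda>\<theta>. (-\<i>) * (\<i> * G (r * cis \<theta>))) has_integral (-\<i>) * (2 * of_real pi * \<i> * G 0)) {0..2*pi}"
    by (rule has_integral_mult_right)
  hence "((\<lambda>\<theta>. G (r * cis \<theta>)) has_integral 2 * of_real pi * G 0) {0..2*pi}" by (simp add: mult_ac)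
  from has_integral_Re[OF this]
  have "((\<lambda>\<theta>. Re (G (r * cis \<theta>))) has_integral 2 * pi * Re (G 0)) {0..2*pi}" by simp
  also have "(\<lambda>\<theta>. Re (G (r * cis \<theta>))) = (\<lambda>\<theta>. ln (cmod (H (of_real r * cis \<theta>))))"
    using e r by (intro ext Re) (simp add: norm_mult)
  also have "Re (G 0) = ln (cmod (H 0))" using e r by (intro Re) auto
  finally show ?thesis .
qed

text \<open>Reciprocal of the usual Blaschke factor of the disc of radius r: its pole at a is
  simple, so its power with exponent \<open>zorder g a\<close> cancels the zero or pole of g. For a
  \<noteq> 0 with |a| < r its zero r^2/cnj a lies outside the closed disc.\<close>

definition blaschke :: "real \<Rightarrow> complex \<Rightarrow> complex \<Rightarrow> complex" where
  "blaschke r a z = (of_real r ^ 2 - cnj a * z) / (of_real r * (z - a))"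

lemma blaschke_numerator_nonzero:
  assumes "cmod a < r" "cmod x \<le> r"
  shows "of_real r ^ 2 - cnj a * x \<noteq> 0"
proof
  assume "of_real r ^ 2 - cnj a * x = 0"
  hence "cnj a * x = of_real r ^ 2" by simp
  hence "cmod a * cmod x = r ^ 2"
    by (metis abs_power2 complex_mod_cnj norm_mult norm_of_real of_real_power)
  moreover have "cmod a * cmod x \<le> cmod a * r" using assms by (intro mult_left_mono) auto
  moreover have "cmod a * r < r * r" using assms norm_ge_zero[of a] by (intro mult_strict_right_mono) linarith+
  ultimately show False by (simp add: power2_eq_square)
qed

lemma blaschke_analytic_nonzero:
  assumes "cmod a < r" "cmod x \<le> r" "x \<noteq> a"
  shows "blaschke r a analytic_on {x}" "blaschke r a x \<noteq> 0"
proof -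
  have r: "r \<noteq> 0" using assms(1) by auto
  show "blaschke r a analytic_on {x}"
    unfolding blaschke_def[abs_def] using assms r by (intro analytic_intros) auto
  show "blaschke r a x \<noteq> 0"
    using blaschke_numerator_nonzero[OF assms(1,2)] assms(3) r by (simp add: blaschke_def)
qed

lemma zorder_blaschke:
  assumes "cmod a < r" "cmod x \<le> r"
  shows "zorder (blaschke r a) x = (if x = a then -1 else 0)"
proof (cases "x = a")
  case True
  have r: "r \<noteq> 0" using assms(1) by auto
  have "zorder (blaschke r a) a = -1"
  proof (rule zorder_eqI[of UNIV])
    show "(\<lambda>z. (of_real r ^ 2 - cnj a * z) / of_real r) holomorphic_on UNIV"
      using r by (intro holomorphic_intros) auto
    show "(of_real r ^ 2 - cnj a * a) / of_real r \<noteq> 0"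
      using blaschke_numerator_nonzero[OF assms(1), of a] assms r by simp
    show "blaschke r a w = (of_real r ^ 2 - cnj a * w) / of_real r * (w - a) powi -1" for w
      by (simp add: blaschke_def field_simps)
  qed auto
  thus ?thesis using True by simp
next
  case False
  thus ?thesis using blaschke_analytic_nonzero[OF assms False] by (simp add: zorder_eq_0I)
qed

lemma norm_blaschke:
  assumes "cmod a < r" "cmod x = r"
  shows "cmod (blaschke r a x) = 1"
proof -
  have r: "r > 0" using assms norm_ge_zero[of a] by linarith
  have "of_real r ^ 2 = x * cnj x" using assms(2) complex_norm_square[of x] by simp
  hence "of_real r ^ 2 - cnj a * x = x * cnj (x - a)" by (simp add: algebra_simps)
  hence "cmod (of_real r ^ 2 - cnj a * x) = r * cmod (x - a)"
    by (simp only: norm_mult complex_mod_cnj assms(2))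
  moreover have "x \<noteq> a" using assms by auto
  ultimately show ?thesis using r by (simp add: blaschke_def norm_divide norm_mult)
qed

lemma blaschke_meromorphic: "blaschke r a meromorphic_on A"
  unfolding blaschke_def[abs_def]
  by (intro meromorphic_intros analytic_on_imp_meromorphic_on analytic_intros)

lemma eventually_blaschke_nonzero:
  assumes "cmod a < r" "cmod x \<le> r"
  shows "eventually (\<lambda>w. blaschke r a w \<noteq> 0) (at x)"
proof -
  have "isCont (\<lambda>w. of_real r ^ 2 - cnj a * w) x" by (intro continuous_intros)
  hence "((\<lambda>w. of_real r ^ 2 - cnj a * w) \<longlongrightarrow> of_real r ^ 2 - cnj a * x) (at x)"
    by (simp add: isCont_def)
  hence "eventually (\<lambda>w. of_real r ^ 2 - cnj a * w \<noteq> 0) (at x)"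
    by (rule tendsto_imp_eventually_ne) (rule blaschke_numerator_nonzero[OF assms])
  moreover have "eventually (\<lambda>w. w \<noteq> a) (at x)"
    by (rule eventually_neq_at_within)
  ultimately show ?thesis
    by eventually_elim (use assms in \<open>auto simp: blaschke_def\<close>)
qed

lemma meromorphic_zorder_0_limit:
  assumes "h meromorphic_on {x}" "eventually (\<lambda>w. h w \<noteq> 0) (at x)" "zorder h x = 0"
  shows "remove_sings h analytic_on {x}" "remove_sings h x \<noteq> 0" "(h \<longlongrightarrow> remove_sings h x) (at x)"
proof -
  have fr: "\<exists>\<^sub>F w in at x. h w \<noteq> 0" using assms(2) by (simp add: eventually_frequently)
  obtain r where r: "zor_poly h x x \<noteq> 0" "r > 0" "zor_poly h x holomorphic_on cball x r"
      "\<And>w. w \<in> cball x r - {x} \<Longrightarrow> h w = zor_poly h x w"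
    using zorder_exist[OF _ _ fr] assms unfolding meromorphic_at_iff by auto
  have "isCont (zor_poly h x) x"
    using r(2,3) by (metis centre_in_ball ball_subset_cball continuous_on_eq_continuous_at
        holomorphic_on_imp_continuous_on holomorphic_on_subset open_ball)
  hence "(zor_poly h x \<longlongrightarrow> zor_poly h x x) (at x)" by (simp add: isCont_def)
  moreover have "eventually (\<lambda>w. w \<in> ball x r - {x}) (at x)"
    using r(2) by (intro eventually_at_in_open) auto
  hence "eventually (\<lambda>w. zor_poly h x w = h w) (at x)"
    by eventually_elim (use r(4) in auto)
  ultimately have lim: "(h \<longlongrightarrow> zor_poly h x x) (at x)"
    by (rule Lim_transform_eventually)
  hence eq: "remove_sings h x = zor_poly h x x" by (rule remove_sings_eqI)
  show "remove_sings h analytic_on {x}"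
    using assms(1) lim by (intro remove_sings_analytic_at) (auto simp: meromorphic_at_iff)
  show "remove_sings h x \<noteq> 0" "(h \<longlongrightarrow> remove_sings h x) (at x)" using lim r(1) by (simp_all add: eq)
qed

text \<open>\<open>zor_poly g x x\<close> is the leading Laurent coefficient; at the origin it takes
  the place of g(0) in Jensen's formula.\<close>

lemma zor_poly_tendsto:
  assumes "g meromorphic_on {x}" "eventually (\<lambda>w. g w \<noteq> 0) (at x)"
  shows "zor_poly g x x \<noteq> 0" "((\<lambda>w. g w * (w - x) powi (- zorder g x)) \<longlongrightarrow> zor_poly g x x) (at x)"
proof -
  have fr: "\<exists>\<^sub>F w in at x. g w \<noteq> 0" using assms(2) by (simp add: eventually_frequently)
  obtain r where r: "zor_poly g x x \<noteq> 0" "r > 0" "zor_poly g x holomorphic_on cball x r"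
      "\<And>w. w \<in> cball x r - {x} \<Longrightarrow> g w = zor_poly g x w * (w - x) powi zorder g x"
    using zorder_exist[OF _ _ fr] assms unfolding meromorphic_at_iff by blast
  show "zor_poly g x x \<noteq> 0" by fact
  have "isCont (zor_poly g x) x"
    using r(2,3) by (metis centre_in_ball ball_subset_cball continuous_on_eq_continuous_at
        holomorphic_on_imp_continuous_on holomorphic_on_subset open_ball)
  hence "(zor_poly g x \<longlongrightarrow> zor_poly g x x) (at x)" by (simp add: isCont_def)
  moreover have "eventually (\<lambda>w. w \<in> ball x r - {x}) (at x)"
    using r(2) by (intro eventually_at_in_open) auto
  hence "eventually (\<lambda>w. zor_poly g x w = g w * (w - x) powi (- zorder g x)) (at x)"
    by eventually_elim (use r(4) in \<open>auto simp: power_int_minus\<close>)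
  ultimately show "((\<lambda>w. g w * (w - x) powi (- zorder g x)) \<longlongrightarrow> zor_poly g x x) (at x)"
    by (rule Lim_transform_eventually)
qed

lemma jensen_formula:
  assumes g: "g meromorphic_on UNIV" "eventually (\<lambda>w. g w \<noteq> 0) (cosparse UNIV)"
    and r: "0 < r" and circ: "\<And>x. cmod x = r \<Longrightarrow> g analytic_on {x} \<and> g x \<noteq> 0"
    and S: "finite S" "0 \<in> S" "S \<subseteq> ball 0 r" "\<And>x. x \<in> ball 0 r \<Longrightarrow> x \<notin> S \<Longrightarrow> zorder g x = 0"
  shows "((\<lambda>\<theta>. ln (cmod (g (of_real r * cis \<theta>)))) has_integral
      2 * pi * (ln (cmod (zor_poly g 0 0)) + (\<Sum>a\<in>S. of_int (zorder g a) * log_kernel r a))) {0..2*pi}"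
proof -
  txt \<open>Multiplying by Blaschke factors, which are unimodular on the circle, removes all zeros and poles
    inside the disc.\<close>
  define k where "k = zorder g"
  define P where "P = (\<lambda>z. \<Prod>a\<in>S. blaschke r a z powi k a)"
  define h where "h = (\<lambda>z. g z * P z)"
  have gx: "g meromorphic_on {x}" for x using g(1) by (rule meromorphic_on_subset) auto
  have gev: "eventually (\<lambda>w. g w \<noteq> 0) (at x)" for x
    using g(2) by (rule eventually_cosparse_imp_eventually_at) auto
  have Sr: "cmod a < r" if "a \<in> S" for a using S(3) that by auto
  have Pm: "P meromorphic_on A" for A
    unfolding P_def by (intro meromorphic_intros blaschke_meromorphic)
  have hm: "h meromorphic_on {x}" for x unfolding h_def by (intro meromorphic_intros gx Pm)
  have Pev: "eventually (\<lambda>w. P w \<noteq> 0) (at x)" if x: "cmod x \<le> r" for x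
  proof -
    have "eventually (\<lambda>w. \<forall>a\<in>S. blaschke r a w \<noteq> 0) (at x)"
      using S(1) by (intro eventually_ball_finite ballI eventually_blaschke_nonzero Sr x)
    thus ?thesis by eventually_elim (use S(1) in \<open>auto simp: P_def power_int_eq_0_iff\<close>)
  qed
  have hev: "eventually (\<lambda>w. h w \<noteq> 0) (at x)" if "cmod x \<le> r" for x
    using gev[of x] Pev[OF that] by eventually_elim (auto simp: h_def)
  have zh: "zorder h x = 0" if x: "cmod x \<le> r" for x
  proof -
    have "zorder h x = k x + zorder P x"
      unfolding h_def k_def
      by (intro zorder_mult gx Pm eventually_frequently gev Pev x) auto
    also have "zorder P x = (\<Sum>a\<in>S. zorder (\<lambda>z. blaschke r a z powi k a) x)"
      unfolding P_def using Pev[OF x] by (intro zorder_prod meromorphic_intros blaschke_meromorphic) (simp add: P_def)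
    also have "\<dots> = (\<Sum>a\<in>S. k a * zorder (blaschke r a) x)"
      by (intro sum.cong refl zorder_power_int blaschke_meromorphic eventually_frequently
          eventually_blaschke_nonzero Sr x) auto
    also have "\<dots> = (\<Sum>a\<in>S. if a = x then - k a else 0)"
      by (intro sum.cong refl) (use Sr x zorder_blaschke in auto)
    also have "\<dots> = (if x \<in> S then - k x else 0)" using S(1) by simp
    also have "k x + \<dots> = 0"
    proof (cases "x \<in> S")
      case False
      have "k x = 0"
      proof (cases "cmod x = r")
        case True
        thus ?thesis using circ[of x] by (simp add: k_def zorder_eq_0I)
      qed (use False S(4)[of x] x in \<open>auto simp: k_def\<close>)
      thus ?thesis using False by simp
    qed auto
    finally show ?thesis .
  qed
  \<comment> \<open>At singularities and at points of \<open>S\<close> the product \<open>h\<close>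
    may carry arbitrary values; its order there is 0, so the limits exist and are nonzero.\<close>
  define H where "H = remove_sings h"
  have H: "H analytic_on {x}" "H x \<noteq> 0" "(h \<longlongrightarrow> H x) (at x)" if "cmod x \<le> r" for x
    unfolding H_def by (intro meromorphic_zorder_0_limit hm hev zh that)+
  have "H analytic_on cball 0 r" using H(1) by (subst analytic_on_analytic_at) auto
  hence mean: "((\<lambda>\<theta>. ln (cmod (H (of_real r * cis \<theta>)))) has_integral 2 * pi * ln (cmod (H 0))) {0..2*pi}"
    using H(2) r by (intro ln_cmod_mean_value) auto
  have Hg: "cmod (H x) = cmod (g x)" if x: "cmod x = r" for x
  proof -
    have "P analytic_on {x}" unfolding P_def
      using x Sr blaschke_analytic_nonzero[of _ r x] by (intro analytic_intros) force+
    hence "h analytic_on {x}" unfolding h_def using circ[OF x] by (intro analytic_intros) auto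
    hence "H x = h x" by (simp add: H_def)
    moreover have "cmod (P x) = 1"
      unfolding P_def prod_norm[symmetric] norm_power_int using x Sr norm_blaschke by (intro prod.neutral) auto
    ultimately show ?thesis by (simp add: h_def norm_mult)
  qed
  \<comment> \<open>The factor at the origin is kept apart: combined with g it contributes c r^(k 0)
    in the limit, the source of the kernel value ln r at 0.\<close>
  define Q where "Q = (\<lambda>z. \<Prod>a\<in>S-{0}. blaschke r a z powi k a)"
  have Qc: "(Q \<longlongrightarrow> Q 0) (at 0)"
  proof -
    have "Q analytic_on {0}" unfolding Q_def
      using r Sr blaschke_analytic_nonzero[of _ r 0] by (intro analytic_intros) force+
    thus ?thesis using analytic_at_imp_isCont isCont_def by blast
  qed
  define c where "c = zor_poly g 0 0"
  have c: "c \<noteq> 0" "((\<lambda>w. g w * (w - 0) powi (- k 0)) \<longlongrightarrow> c) (at 0)"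
    unfolding c_def k_def using zor_poly_tendsto[OF gx gev, of 0] by auto
  have "((\<lambda>w. g w * (w - 0) powi (- k 0) * of_real r powi k 0 * Q w) \<longlongrightarrow> c * of_real r powi k 0 * Q 0) (at 0)"
    by (intro tendsto_intros c(2) Qc)
  moreover have "eventually (\<lambda>w. g w * (w - 0) powi (- k 0) * of_real r powi k 0 * Q w = h w) (at 0)"
    using eventually_neq_at_within[of "0::complex" 0 UNIV]
  proof eventually_elim
    case (elim w)
    have b: "blaschke r 0 w = of_real r / w" using r by (simp add: blaschke_def power2_eq_square)
    have "P w = blaschke r 0 w powi k 0 * Q w"
      unfolding P_def Q_def using S by (subst prod.remove[of S 0]) auto
    thus ?case using elim unfolding b
      by (simp add: h_def power_int_divide_distrib power_int_minus field_simps)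
  qed
  ultimately have "(h \<longlongrightarrow> c * of_real r powi k 0 * Q 0) (at 0)"
    by (rule Lim_transform_eventually)
  hence "H 0 = c * of_real r powi k 0 * Q 0"
    using tendsto_unique[OF _ H(3)[of 0]] r by simp
  moreover have nb: "cmod (blaschke r a 0) = r / cmod a" if "a \<in> S - {0}" for a
    using r by (simp add: blaschke_def norm_divide norm_mult power2_eq_square norm_power)
  have "cmod (Q 0) = (\<Prod>a\<in>S-{0}. (r / cmod a) powi k a)"
    unfolding Q_def prod_norm[symmetric] norm_power_int by (intro prod.cong refl) (simp add: nb)
  ultimately have "ln (cmod (H 0)) = ln (cmod c * r powi k 0 * (\<Prod>a\<in>S-{0}. (r / cmod a) powi k a))"
    using r by (simp add: norm_mult norm_power_int)
  also have "\<dots> = ln (cmod c) + k 0 * ln r + ln (\<Prod>a\<in>S-{0}. (r / cmod a) powi k a)"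
  proof -
    have "(\<Prod>a\<in>S-{0}. (r / cmod a) powi k a) > 0" using r by (intro prod_pos) auto
    thus ?thesis using c(1) r by (simp add: ln_mult ln_powi)
  qed
  also have "ln (\<Prod>a\<in>S-{0}. (r / cmod a) powi k a) = (\<Sum>a\<in>S-{0}. ln ((r / cmod a) powi k a))"
    using r S(1) by (intro ln_prod) auto
  also have "\<dots> = (\<Sum>a\<in>S-{0}. k a * log_kernel r a)"
    using r Sr by (intro sum.cong refl) (auto simp: log_kernel_def ln_powi)
  also have "ln (cmod c) + k 0 * ln r + \<dots> = ln (cmod c) + (\<Sum>a\<in>S. k a * log_kernel r a)"
    using S by (subst sum.remove[of S 0]) (auto simp: log_kernel_def)
  finally have H0: "ln (cmod (H 0)) = ln (cmod (zor_poly g 0 0)) + (\<Sum>a\<in>S. zorder g a * log_kernel r a)"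
    by (simp add: k_def c_def)
  have "(\<lambda>\<theta>. ln (cmod (H (of_real r * cis \<theta>)))) = (\<lambda>\<theta>. ln (cmod (g (of_real r * cis \<theta>))))"
    using r by (intro ext arg_cong[of _ _ ln] Hg) (simp add: norm_mult)
  with mean H0 show ?thesis by simp
qed

subsection \<open>Bounding zeros by the characteristic\<close>

lemma logp_eq: "logp x = ln (max 1 x)"
  by (simp add: logp_def max_def)

lemma logp_nonneg: "0 \<le> logp x"
  by (simp add: logp_def)

lemma ln_norm_diff_le:
  fixes u a :: complex
  assumes "u \<noteq> a"
  shows "ln (cmod (u - a)) \<le> logp (cmod u) + logp (cmod a) + ln 2"
proof -
  have "cmod (u - a) \<le> cmod u + cmod a" by (rule norm_triangle_ineq4)
  also have "\<dots> \<le> max 1 (cmod u) * max 1 (cmod a) + max 1 (cmod u) * max 1 (cmod a)"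
  proof (rule add_mono)
    show "cmod u \<le> max 1 (cmod u) * max 1 (cmod a)"
      using mult_mono[of "cmod u" "max 1 (cmod u)" 1 "max 1 (cmod a)"] by simp
    show "cmod a \<le> max 1 (cmod u) * max 1 (cmod a)"
      using mult_mono[of 1 "max 1 (cmod u)" "cmod a" "max 1 (cmod a)"] by simp
  qed
  also have "\<dots> = max 1 (cmod u) * max 1 (cmod a) * 2" by simp
  finally have "ln (cmod (u - a)) \<le> ln (max 1 (cmod u) * max 1 (cmod a) * 2)"
    using assms by (subst ln_le_cancel_iff) (auto intro!: mult_pos_pos)
  also have "\<dots> = logp (cmod u) + logp (cmod a) + ln 2"
    unfolding logp_eq by (simp add: ln_mult_pos mult_pos_pos)
  finally show ?thesis .
qed

definition zero_mult :: "(complex \<Rightarrow> complex) \<Rightarrow> complex \<Rightarrow> real" where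
  "zero_mult g x = enr (nu0 g x)"

lemma zero_mult_nonneg: "0 \<le> zero_mult g x"
  by (simp add: zero_mult_def enr_def split: enat.split)

text \<open>Nonvanishing off a sparse set keeps \<open>nu0 g\<close> finite, so the default value of
  \<open>enr\<close> at infinity is never met there; a minimum with \<open>nu0 g\<close> stays
  finite even if \<open>aw_D p g\<close> vanishes identically.\<close>

locale nonzero_meromorphic =
  fixes g :: "complex \<Rightarrow> complex"
  assumes mero: "g meromorphic_on UNIV"
    and nonzero: "eventually (\<lambda>w. g w \<noteq> 0) (cosparse UNIV)"
begin

lemma mero_at: "g meromorphic_on {x}"
  using mero by (rule meromorphic_on_subset) auto

lemma ev_nonzero: "eventually (\<lambda>w. g w \<noteq> 0) (at x)"
  using nonzero by (rule eventually_cosparse_imp_eventually_at) auto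

lemma nu0_eq: "nu0 g x = enat (nat (zorder g x))"
proof -
  have "\<not> eventually (\<lambda>w. g w = 0) (at x)"
    using eventually_frequently[OF _ ev_nonzero[of x]] by (simp add: frequently_def)
  thus ?thesis by (simp add: nu0_def)
qed

lemma zero_mult_eq: "zero_mult g x = real (nat (zorder g x))"
  by (simp add: zero_mult_def nu0_eq enr_def)

lemma eventually_regular: "eventually (\<lambda>x. g analytic_on {x} \<and> g x \<noteq> 0) (cosparse UNIV)"
  using meromorphic_on_imp_analytic_cosparse[OF mero] nonzero by (rule eventually_conj)

lemma finite_zorder: "finite {x\<in>ball 0 R. zorder g x \<noteq> 0}"
  by (rule finite_subset[OF _ finite_cosparse_ball[OF eventually_regular, of R]])
     (use zorder_eq_0I[of g] in blast)

lemma finite_zero_mult: "finite {x\<in>ball 0 R. zero_mult g x \<noteq> 0}"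
  by (rule finite_subset[OF _ finite_zorder[of R]]) (auto simp: zero_mult_eq)

text \<open>Jensen's formula is only used off these countably many radii, which avoids integrating
  logarithmic singularities on the circle; they are absorbed into the exceptional set.\<close>

definition critical_radii :: "real set" where
  "critical_radii = cmod ` {x. \<not> (g analytic_on {x} \<and> g x \<noteq> 0)}"

lemma countable_critical_radii: "countable critical_radii"
proof -
  have "countable (\<Union>n. {x\<in>ball 0 (real n). \<not> (g analytic_on {x} \<and> g x \<noteq> 0)})"
    by (intro countable_UN countableI_type countable_finite finite_cosparse_ball[OF eventually_regular])
  also have "(\<Union>n. {x\<in>ball 0 (real n). \<not> (g analytic_on {x} \<and> g x \<noteq> 0)})
      = {x. \<not> (g analytic_on {x} \<and> g x \<noteq> 0)}"
    using reals_Archimedean2 by auto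
  finally show ?thesis unfolding critical_radii_def by (rule countable_image)
qed

lemma is_pole_imp_zorder_neg: "is_pole g x \<Longrightarrow> zorder g x < 0"
  using mero_at isolated_pole_imp_neg_zorder meromorphic_at_iff by blast

lemma is_pole_iff_zorder_neg: "is_pole g x \<longleftrightarrow> zorder g x < 0"
  using is_pole_imp_zorder_neg zorder_neg_imp_is_pole[OF mero_at ev_nonzero] by blast

end

lemma nev_m_nonneg: "0 \<le> nev_m f r"
proof (cases "(\<lambda>\<theta>. logp (cmod (f (complex_of_real r * cis \<theta>)))) integrable_on {0..2*pi}")
  case True
  thus ?thesis unfolding nev_m_def by (intro divide_nonneg_pos integral_nonneg) (auto simp: logp_nonneg)
qed (simp add: nev_m_def not_integrable_integral)

text \<open>Jensen's formula gives the mean of ln |f - a| as a constant plus zero count minus pole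
  count, and ln |f - a| \<le> log+ |f| + log+ |a| + ln 2. The poles of f and f - a agree, with
  orders.\<close>

lemma first_main_inequality:
  assumes g: "nonzero_meromorphic (\<lambda>x. f x - a)"
  shows "\<exists>C. \<forall>r>0. r \<notin> nonzero_meromorphic.critical_radii (\<lambda>x. f x - a) \<longrightarrow>
     int_count (zero_mult (\<lambda>x. f x - a)) r \<le> nev_T f r + C"
proof -
  let ?g = "\<lambda>x. f x - a"
  interpret nonzero_meromorphic ?g by fact
  define C where "C = logp (cmod a) + ln 2 - ln (cmod (zor_poly ?g 0 0))"
  have "int_count (zero_mult ?g) r \<le> nev_T f r + C" if r: "0 < r" and rc: "r \<notin> critical_radii" for r
  proof -
    have circ: "?g analytic_on {x} \<and> ?g x \<noteq> 0" if "cmod x = r" for x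
      using rc that by (auto simp: critical_radii_def)
    define S where "S = insert 0 {x\<in>ball 0 r. zorder ?g x \<noteq> 0}"
    have S: "finite S" "0 \<in> S" "S \<subseteq> ball 0 r" "\<And>x. x \<in> ball 0 r \<Longrightarrow> x \<notin> S \<Longrightarrow> zorder ?g x = 0"
      using finite_zorder r by (auto simp: S_def)
    define w where "w = (\<lambda>x. if is_pole f x then real (nat (- zorder f x)) else 0)"
    have pole: "is_pole f x \<longleftrightarrow> zorder ?g x < 0" for x
      using is_pole_iff_zorder_neg[of x] by (simp add: is_pole_minus_const_iff)
    have zf: "zorder f x = zorder ?g x" if "is_pole f x" for x
    proof (cases "a = 0")
      case False
      have fm: "f meromorphic_on {x}"
        using meromorphic_on_add[OF mero_at[of x] meromorphic_on_const[of a]] by simp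
      have "zorder f x < 0"
        using fm that isolated_pole_imp_neg_zorder meromorphic_at_iff by blast
      hence "zorder (\<lambda>z. f z - a) x = zorder f x"
        using False non_zero_neighbour_pole[OF that]
        by (intro zorder_diff1 fm meromorphic_on_const) (auto intro: eventually_frequently)
      thus ?thesis by simp
    qed simp
    have ord: "real_of_int (zorder ?g x) = zero_mult ?g x - w x" for x
      using zf[of x] pole[of x] by (auto simp: zero_mult_eq w_def)
    have N: "nev_N f r = (\<Sum>x\<in>S. w x * log_kernel r x)"
      unfolding w_def
    proof (rule nev_N_eq_sum[OF S(1) _ r])
      \<comment> \<open>\<open>pole_count\<close> uses closed discs while \<open>S\<close> is in the
        open one; a noncritical radius has no poles on the circle.\<close>
      show "{x \<in> cball 0 r. is_pole f x} \<subseteq> S"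
      proof
        fix x assume x: "x \<in> {x \<in> cball 0 r. is_pole f x}"
        have "cmod x \<noteq> r" using circ[of x] x pole[of x] by (auto simp: zorder_eq_0I)
        thus "x \<in> S" using x pole[of x] by (auto simp: S_def)
      qed
    qed
    have n: "int_count (zero_mult ?g) r = (\<Sum>x\<in>S. zero_mult ?g x * log_kernel r x)"
      by (rule int_count_eq_sum[OF S(1) _ r]) (auto simp: S_def zero_mult_eq)
    have "((\<lambda>\<theta>. ln (cmod (?g (of_real r * cis \<theta>)))) has_integral
      2 * pi * (ln (cmod (zor_poly ?g 0 0)) + (\<Sum>a\<in>S. of_int (zorder ?g a) * log_kernel r a))) {0..2*pi}"
      by (rule jensen_formula[OF mero nonzero r circ S])
    also have "(\<Sum>a\<in>S. of_int (zorder ?g a) * log_kernel r a) = int_count (zero_mult ?g) r - nev_N f r"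
      unfolding N n ord by (simp add: left_diff_distrib sum_subtractf)
    finally have J: "((\<lambda>\<theta>. ln (cmod (?g (of_real r * cis \<theta>)))) has_integral
      2 * pi * (ln (cmod (zor_poly ?g 0 0)) + (int_count (zero_mult ?g) r - nev_N f r))) {0..2*pi}" .
    \<comment> \<open>Continuity on the circle ensures that \<open>nev_m\<close> is a true integral
      here and not the default value 0.\<close>
    have "continuous_on (sphere 0 r) ?g"
      using circ by (intro analytic_imp_holomorphic holomorphic_on_imp_continuous_on)
        (subst analytic_on_analytic_at, auto)
    from continuous_on_add[OF this continuous_on_const, of a]
    have "continuous_on (sphere 0 r) f" by simp
    hence "continuous_on {0..2*pi} (\<lambda>\<theta>. f (of_real r * cis \<theta>))"
      by (rule continuous_on_compose2) (use r in \<open>auto intro!: continuous_intros simp: norm_mult\<close>)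
    hence "continuous_on {0..2*pi} (\<lambda>\<theta>. logp (cmod (f (of_real r * cis \<theta>))))"
      unfolding logp_eq by (intro continuous_intros continuous_on_max) auto
    hence "(\<lambda>\<theta>. logp (cmod (f (of_real r * cis \<theta>)))) integrable_on {0..2*pi}"
      by (rule integrable_continuous_real)
    hence "((\<lambda>\<theta>. logp (cmod (f (of_real r * cis \<theta>)))) has_integral 2 * pi * nev_m f r) {0..2*pi}"
      by (simp add: nev_m_def has_integral_integral)
    from has_integral_add[OF this has_integral_const_real[of "logp (cmod a) + ln 2" 0 "2 * pi"]]
    have M: "((\<lambda>\<theta>. logp (cmod (f (of_real r * cis \<theta>))) + (logp (cmod a) + ln 2)) has_integral
        2 * pi * (nev_m f r + (logp (cmod a) + ln 2))) {0..2*pi}"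
      by (simp add: distrib_left)
    have "2 * pi * (ln (cmod (zor_poly ?g 0 0)) + (int_count (zero_mult ?g) r - nev_N f r))
        \<le> 2 * pi * (nev_m f r + (logp (cmod a) + ln 2))"
    proof (rule has_integral_le[OF J M])
      fix \<theta>
      have "f (of_real r * cis \<theta>) \<noteq> a"
        using circ[of "of_real r * cis \<theta>"] r by (simp add: norm_mult)
      from ln_norm_diff_le[OF this]
      show "ln (cmod (?g (of_real r * cis \<theta>))) \<le> logp (cmod (f (of_real r * cis \<theta>))) + (logp (cmod a) + ln 2)"
        by simp
    qed
    hence "ln (cmod (zor_poly ?g 0 0)) + (int_count (zero_mult ?g) r - nev_N f r)
        \<le> nev_m f r + (logp (cmod a) + ln 2)"
      by simp
    thus ?thesis by (simp add: nev_T_def C_def)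
  qed
  thus ?thesis by blast
qed

text \<open>By the identity theorem a nonconstant f takes each value only on a sparse set.\<close>

lemma nonzero_meromorphic_fsub:
  assumes f: "f nicely_meromorphic_on UNIV" "\<not> (\<exists>c. \<forall>x. f x = c)"
  shows "nonzero_meromorphic (fsub f a)"
proof -
  have m: "f meromorphic_on UNIV" using f(1) by (simp add: nicely_meromorphic_on_def)
  have ne: "eventually (\<lambda>x. f x \<noteq> c) (cosparse UNIV)" for c
    using nicely_meromorphic_imp_constant_or_avoid[OF f(1), of c] f(2) by auto
  show ?thesis
  proof (cases a)
    case None
    thus ?thesis using m ne[of 0] by unfold_locales (auto intro!: meromorphic_intros)
  next
    case (Some c)
    thus ?thesis using m ne[of c] by unfold_locales (auto intro!: meromorphic_intros)
  qed
qed

lemma nev_N_nonneg: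
  assumes f: "nonzero_meromorphic f" and r: "1 \<le> r"
  shows "0 \<le> nev_N f r"
proof -
  interpret nonzero_meromorphic f by fact
  have fin: "finite {x\<in>cball 0 r. is_pole f x}"
    by (rule finite_subset[OF _ finite_zorder[of "r + 1"]]) (auto simp: is_pole_iff_zorder_neg)
  have "nev_N f r = (\<Sum>x\<in>{x\<in>cball 0 r. is_pole f x}.
      (if is_pole f x then real (nat (- zorder f x)) else 0) * log_kernel r x)"
    by (rule nev_N_eq_sum[OF fin]) (use r in auto)
  also have "\<dots> \<ge> 0" using r by (intro sum_nonneg mult_nonneg_nonneg log_kernel_nonneg) auto
  finally show ?thesis .
qed

text \<open>Inversion negates \<open>zorder\<close>. This settles a = \<infinity>, where N \<le> T
  follows from m \<ge> 0.\<close>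

lemma int_count_zero_mult_inverse:
  assumes f: "nonzero_meromorphic f" and r: "0 < r"
  shows "int_count (zero_mult (\<lambda>x. inverse (f x))) r = nev_N f r"
proof -
  interpret nonzero_meromorphic f by fact
  let ?w = "\<lambda>x. if is_pole f x then real (nat (- zorder f x)) else 0"
  interpret i: nonzero_meromorphic "\<lambda>x. inverse (f x)"
    using mero nonzero by unfold_locales (auto intro!: meromorphic_intros)
  have eq: "zero_mult (\<lambda>x. inverse (f x)) = ?w"
  proof
    fix x
    have "zorder (\<lambda>x. inverse (f x)) x = - zorder f x"
      using mero_at[of x] ev_nonzero[of x]
      by (intro zorder_inverse) (auto simp: meromorphic_at_iff intro: eventually_frequently)
    thus "zero_mult (\<lambda>x. inverse (f x)) x = ?w x"
      unfolding i.zero_mult_eq is_pole_iff_zorder_neg by auto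
  qed
  \<comment> \<open>Radius r + 1 covers both the open disc of \<open>int_count\<close> and the
    closed disc of \<open>nev_N\<close>.\<close>
  define S where "S = {x\<in>ball 0 (r + 1). zorder f x \<noteq> 0}"
  have "int_count ?w r = (\<Sum>x\<in>S. ?w x * log_kernel r x)"
    using r finite_zorder by (intro int_count_eq_sum) (auto simp: S_def)
  also have "\<dots> = nev_N f r"
    using r finite_zorder by (intro nev_N_eq_sum[symmetric]) (auto simp: S_def is_pole_iff_zorder_neg)
  finally show ?thesis unfolding eq .
qed

lemma int_count_zeros_le_nev_T:
  assumes f: "f nicely_meromorphic_on UNIV" "\<not> (\<exists>c. \<forall>x. f x = c)"
  shows "\<exists>C. \<forall>r>0. r \<notin> nonzero_meromorphic.critical_radii (fsub f a) \<longrightarrow>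
     int_count (zero_mult (fsub f a)) r \<le> nev_T f r + C"
proof (cases a)
  case None
  have "nonzero_meromorphic f" using nonzero_meromorphic_fsub[OF f, of "Some 0"] by simp
  hence "int_count (zero_mult (fsub f a)) r \<le> nev_T f r + 0" if "0 < r" for r
    using int_count_zero_mult_inverse[of f r] that nev_m_nonneg[of f r] None by (simp add: nev_T_def)
  thus ?thesis by blast
next
  case (Some c)
  thus ?thesis using first_main_inequality[of f c] nonzero_meromorphic_fsub[OF f, of a] by simp
qed

subsection \<open>The comparison\<close>

lemma norm_joukowski_le: "1 \<le> cmod z \<Longrightarrow> cmod (joukowski z) \<le> cmod z"
  using norm_triangle_ineq[of z "inverse z"] inverse_le_1_iff[of "cmod z"]
  by (simp add: joukowski_def norm_divide norm_inverse)

lemma norm_joukowski_ge: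
  assumes "2 \<le> cmod z"
  shows "cmod z / 4 \<le> cmod (joukowski z)"
proof -
  have "cmod z - cmod (inverse z) \<le> cmod (z + inverse z)" by (rule norm_diff_ineq)
  moreover have "cmod (inverse z) \<le> 1 / 2"
    using assms le_imp_inverse_le[of 2 "cmod z"] by (simp add: norm_inverse)
  ultimately show ?thesis using assms by (simp add: joukowski_def norm_divide)
qed

lemma norm_aw_z_ge: "cmod x \<le> cmod (aw_z x)"
  using norm_joukowski_le[OF aw_z_props(1)[of x]] by (simp add: aw_z_props(2))

lemma norm_aw_z_le: "cmod (aw_z x) \<le> 4 * cmod x + 2"
proof (cases "2 \<le> cmod (aw_z x)")
  case True
  thus ?thesis using norm_joukowski_ge[of "aw_z x"] by (simp add: aw_z_props(2))
next
  case False
  thus ?thesis using norm_ge_zero[of x] by linarith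
qed

context nonzero_meromorphic
begin

lemma aw_weight_eq: "aw_weight p g z = zero_mult g (joukowski (z / p))
    - min (zero_mult g (joukowski (p * z))) (zero_mult g (joukowski (z / p)))"
  by (simp add: aw_weight_def zero_mult_def nu0_eq enr_def min_def)

lemma aw_n_pt_bounds: "0 \<le> aw_n_pt p g x" "aw_n_pt p g x \<le> zero_mult g x"
  by (auto simp: aw_n_pt_def zero_mult_def nu0_eq enr_def min_def split: enat.split)

text \<open>Off the finite set \<open>E\<close> a nonzero weight forces a zero of g at y = J(z/p),
  as the subtracted minimum lies between 0 and the first term. Since |z/p| > 1, x is recovered from
  y.\<close>

lemma finite_aw_nM_pt:
  assumes p: "p \<noteq> 0" "cmod p < 1"
  shows "finite {x\<in>ball 0 R. aw_nM_pt p 1 g x \<noteq> 0}"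
proof -
  define E where "E = joukowski ` {1, -1, inverse p, - inverse p, p, - p}"
  \<comment> \<open>From |y| \<le> |z|/|p| and |z| \<le> 4 |x| + 2.\<close>
  define R' where "R' = (4 * R + 2) / cmod p + 1"
  have p2: "p\<^sup>2 \<noteq> 1" using p by (metis norm_one norm_power power2_eq_1_iff less_irrefl norm_minus_cancel)
  have "{x\<in>ball 0 R. aw_nM_pt p 1 g x \<noteq> 0}
      \<subseteq> E \<union> (\<lambda>y. joukowski (p * aw_z y)) ` {y\<in>ball 0 R'. zero_mult g y \<noteq> 0}"
  proof
    fix x assume x: "x \<in> {x\<in>ball 0 R. aw_nM_pt p 1 g x \<noteq> 0}"
    define z where "z = aw_z x"
    have z: "1 \<le> cmod z" "joukowski z = x" unfolding z_def by (rule aw_z_props)+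
    show "x \<in> E \<union> (\<lambda>y. joukowski (p * aw_z y)) ` {y\<in>ball 0 R'. zero_mult g y \<noteq> 0}"
    proof (cases "z\<^sup>2 = 1 \<or> (p * z)\<^sup>2 = 1 \<or> (z / p)\<^sup>2 = 1")
      case True
      hence "z \<in> {1, -1, inverse p, - inverse p, p, - p}"
      proof (elim disjE)
        assume "(p * z)\<^sup>2 = 1"
        hence "p * z = 1 \<or> p * z = -1" by (simp only: power2_eq_1_iff)
        moreover have "z = inverse p * (p * z)" using p(1) by simp
        ultimately have "z = inverse p * 1 \<or> z = inverse p * -1" by metis
        thus ?thesis by auto
      next
        assume "(z / p)\<^sup>2 = 1"
        hence "z / p = 1 \<or> z / p = -1" by (simp only: power2_eq_1_iff)
        moreover have "z = p * (z / p)" using p(1) by simp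
        ultimately have "z = p * 1 \<or> z = p * -1" by metis
        thus ?thesis by auto
      qed (auto simp: power2_eq_1_iff)
      thus ?thesis using z(2) unfolding E_def by blast
    next
      case False
      define y where "y = joukowski (z / p)"
      have zp: "1 < cmod (z / p)" using z(1) p by (simp add: norm_divide field_simps)
      have "aw_weight p g z \<noteq> 0"
        using x aw_nM_pt_eq_weight[OF mero p(1) p2, of x] False by (simp add: z_def)
      hence "zero_mult g y \<noteq> 0"
        using zero_mult_nonneg[of g "joukowski (p * z)"] by (auto simp: aw_weight_eq y_def min_def split: if_splits)
      moreover have "cmod y \<le> cmod (z / p)" unfolding y_def using zp by (intro norm_joukowski_le) auto
      hence "cmod y \<le> cmod z / cmod p" by (simp add: norm_divide)
      moreover have "cmod z / cmod p \<le> (4 * R + 2) / cmod p"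
        using norm_aw_z_le[of x] x p by (intro divide_right_mono) (auto simp: z_def)
      ultimately have "y \<in> {y\<in>ball 0 R'. zero_mult g y \<noteq> 0}" by (simp add: R'_def)
      moreover have "aw_z y = z / p" unfolding y_def by (rule aw_z_joukowski[OF zp])
      hence "x = joukowski (p * aw_z y)" using z(2) p(1) by simp
      ultimately show ?thesis by blast
    qed
  qed
  thus ?thesis by (rule finite_subset) (use finite_zero_mult in \<open>auto simp: E_def\<close>)
qed

lemma aw_counting_difference:
  assumes p: "p \<noteq> 0" "cmod p < 1"
  shows "\<exists>C \<kappa>. 1 \<le> \<kappa> \<and> (\<forall>r\<ge>exp 1. \<bar>N_AW_M p 1 g r - N_AW p g r\<bar>
      \<le> C * ln r + ln \<kappa> * disc_count (zero_mult g) (\<kappa> * r))"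
proof -
  \<comment> \<open>Beyond R1 the points z, p z and p^2 z have modulus above 2: none is exceptional,
    and \<open>aw_z\<close> returns p z at eta_q x, the image under the matching
    \<open>\<phi>\<close>.\<close>
  define R1 where "R1 = 2 / (cmod p)\<^sup>2"
  \<comment> \<open>The factor 4 is the loss in |w|/4 \<le> |J(w)| \<le> |w| for |w| \<ge> 2, and
    1/|p| undoes the shift by p.\<close>
  define \<kappa> where "\<kappa> = 4 / cmod p"
  define \<phi> where "\<phi> = (\<lambda>x. joukowski (p * aw_z x))"
  have p2: "p\<^sup>2 \<noteq> 1" using p by (metis norm_one norm_power power2_eq_1_iff less_irrefl norm_minus_cancel)
  have cp: "0 < cmod p" using p by simp
  have \<kappa>: "1 \<le> \<kappa>" "4 \<le> \<kappa>" using p cp by (auto simp: \<kappa>_def field_simps)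
  have big: "2 < cmod (p\<^sup>2 * aw_z x)" "2 < cmod (p * aw_z x)" "2 < cmod (aw_z x)" if "R1 < cmod x" for x
  proof -
    have "2 / (cmod p)\<^sup>2 < cmod (aw_z x)" using that norm_aw_z_ge[of x] by (simp add: R1_def)
    thus 1: "2 < cmod (p\<^sup>2 * aw_z x)" using cp by (simp add: norm_mult norm_power field_simps)
    have "cmod (p\<^sup>2 * aw_z x) \<le> 1 * cmod (p * aw_z x)"
      unfolding power2_eq_square mult.assoc norm_mult[of p] using p by (intro mult_right_mono) auto
    with 1 show 2: "2 < cmod (p * aw_z x)" by simp
    have "cmod (p * aw_z x) \<le> 1 * cmod (aw_z x)"
      unfolding norm_mult using p by (intro mult_right_mono) auto
    with 2 show "2 < cmod (aw_z x)" by simp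
  qed
  have sq: "w\<^sup>2 \<noteq> 1" if "2 < cmod w" for w :: complex
    using that by (auto simp: power2_eq_1_iff)
  have z\<phi>: "aw_z (\<phi> x) = p * aw_z x" if "R1 < cmod x" for x
    unfolding \<phi>_def using big[OF that] by (intro aw_z_joukowski) linarith
  have inj: "inj_on \<phi> {x. R1 < cmod x}"
  proof (rule inj_onI)
    fix x y assume xy: "x \<in> {x. R1 < cmod x}" "y \<in> {x. R1 < cmod x}" "\<phi> x = \<phi> y"
    hence "p * aw_z x = aw_z (\<phi> x)" "p * aw_z y = aw_z (\<phi> x)"
      using z\<phi>[of x] z\<phi>[of y] by auto
    hence "p * aw_z x = p * aw_z y" by (rule trans[OF _ sym])
    hence "aw_z x = aw_z y" using p(1) by (metis mult_left_cancel)
    thus "x = y" by (metis aw_z_props(2))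
  qed
  \<comment> \<open>Beyond 8/|p| one has |z/p| > 8/|p|^2, and J loses at most a factor 4, which
    leaves R1 = 2/|p|^2.\<close>
  have surj: "x \<in> \<phi> ` {x. R1 < cmod x}" if x: "8 / cmod p < cmod x" for x
  proof -
    define y where "y = joukowski (aw_z x / p)"
    have "8 / cmod p < cmod (aw_z x)" using x norm_aw_z_ge[of x] by linarith
    hence "8 / cmod p / cmod p < cmod (aw_z x) / cmod p" using cp by (intro divide_strict_right_mono) auto
    hence z: "8 / (cmod p)\<^sup>2 < cmod (aw_z x / p)" by (simp add: norm_divide power2_eq_square)
    have "(cmod p)\<^sup>2 \<le> 1" using p by (simp add: power_le_one)
    hence "8 \<le> 8 / (cmod p)\<^sup>2" using cp by (simp add: field_simps)
    hence z8: "8 < cmod (aw_z x / p)" using z by linarith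
    have "R1 < cmod y" using norm_joukowski_ge[of "aw_z x / p"] z z8 by (simp add: y_def R1_def)
    moreover have "aw_z y = aw_z x / p" unfolding y_def using z8 by (intro aw_z_joukowski) linarith
    hence "\<phi> y = x" using p by (simp add: \<phi>_def aw_z_props(2))
    ultimately show ?thesis by blast
  qed
  have eq: "aw_nM_pt p 1 g (\<phi> x) = aw_n_pt p g x" if x: "R1 < cmod x" for x
  proof -
    note b = big[OF x]
    have "aw_nM_pt p 1 g (\<phi> x) = aw_weight p g (p * aw_z x)"
      using aw_nM_pt_eq_weight[OF mero p(1) p2, of "\<phi> x"] sq[OF b(1)] sq[OF b(2)] sq[OF b(3)] p(1)
      by (simp add: z\<phi>[OF x] power2_eq_square mult.assoc)
    also have "\<dots> = aw_n_pt p g x"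
      by (rule aw_n_pt_eq_weight[OF mero p(1) p2 sq[OF b(3)] sq[OF b(2)] sq[OF b(1)], symmetric])
    finally show ?thesis .
  qed
  have up: "cmod (\<phi> x) \<le> \<kappa> * cmod x" if x: "R1 < cmod x" for x
  proof -
    note b = big[OF x]
    have "cmod (\<phi> x) \<le> cmod (p * aw_z x)" unfolding \<phi>_def using b by (intro norm_joukowski_le) linarith
    also have "\<dots> \<le> 1 * cmod (aw_z x)" unfolding norm_mult using p by (intro mult_right_mono) auto
    also have "\<dots> \<le> 4 * cmod x" using norm_joukowski_ge[of "aw_z x"] b by (simp add: aw_z_props(2))
    also have "\<dots> \<le> \<kappa> * cmod x" using \<kappa> by (intro mult_right_mono) auto
    finally show ?thesis .
  qed
  have low: "cmod x \<le> \<kappa> * cmod (\<phi> x)" if x: "R1 < cmod x" for x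
  proof -
    note b = big[OF x]
    have "cmod x \<le> cmod (aw_z x)" by (rule norm_aw_z_ge)
    also have "\<dots> = cmod (p * aw_z x) / cmod p" using cp by (simp add: norm_mult)
    also have "\<dots> \<le> (4 * cmod (\<phi> x)) / cmod p"
      using norm_joukowski_ge[of "p * aw_z x"] b cp by (intro divide_right_mono) (auto simp: \<phi>_def)
    finally show ?thesis by (simp add: \<kappa>_def)
  qed
  have "0 \<le> R1" by (simp add: R1_def)
  from int_count_transport[OF finite_zero_mult finite_aw_nM_pt[OF p] aw_n_pt_bounds inj surj eq \<kappa>(1) up low this]
  obtain C where "\<forall>r\<ge>exp 1. \<bar>int_count (aw_nM_pt p 1 g) r - int_count (aw_n_pt p g) r\<bar>
      \<le> C * ln r + ln \<kappa> * disc_count (zero_mult g) (\<kappa> * r)" by blast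
  thus ?thesis using \<kappa>(1) unfolding N_AW_M_def N_AW_def by blast
qed

end

lemma sigma2_log_less_1_bound:
  assumes "sigma2_log f < 1"
  obtains \<sigma> r0 where "0 < \<sigma>" "\<sigma> < 1" "\<And>r. r0 \<le> r \<Longrightarrow> nev_T f r \<le> exp (ln r powr \<sigma>)"
proof -
  obtain \<sigma>' where s': "sigma2_log f < \<sigma>'" "\<sigma>' < 1" using dense[OF assms] by blast
  \<comment> \<open>The floor 1/2 makes the exponent real and positive; (ln r)^\<sigma> \<ge> 1 then
    covers the case \<open>logp (nev_T f r) \<le> 1\<close>.\<close>
  define \<sigma>'' where "\<sigma>'' = max \<sigma>' (ereal (1 / 2))"
  have "sigma2_log f < \<sigma>''" "\<sigma>'' < 1" "ereal (1 / 2) \<le> \<sigma>''"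
    using s' by (auto simp: \<sigma>''_def less_max_iff_disj one_ereal_def)
  then obtain \<sigma> where s: "sigma2_log f < ereal \<sigma>" "\<sigma> < 1" "1 / 2 \<le> \<sigma>"
    by (cases \<sigma>'') (auto simp: one_ereal_def)
  have "\<forall>\<^sub>F r in at_top. ereal (logp (logp (nev_T f r)) / ln (ln r)) < ereal \<sigma>"
    using s(1) unfolding sigma2_log_def by (rule Limsup_lessD)
  moreover have "\<forall>\<^sub>F r::real in at_top. exp (exp 1) \<le> r" by (rule eventually_ge_at_top)
  ultimately have "\<forall>\<^sub>F r in at_top. nev_T f r \<le> exp (ln r powr \<sigma>)"
  proof eventually_elim
    case (elim r)
    have r0: "0 < r" using elim(2) by (rule less_le_trans[rotated]) simp
    have lr: "exp 1 \<le> ln r" using elim(2) r0 by (subst ln_ge_iff) auto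
    have lr1: "1 \<le> ln r" using lr one_le_exp_iff[of "1::real"] by linarith
    have llr: "1 \<le> ln (ln r)" using lr lr1 by (subst ln_ge_iff) auto
    have *: "logp (logp (nev_T f r)) < \<sigma> * ln (ln r)" using elim(1) llr by (simp add: field_simps)
    have one: "1 \<le> ln r powr \<sigma>" using lr1 s(3) by (intro ge_one_powr_ge_zero) auto
    have "logp (nev_T f r) \<le> ln r powr \<sigma>"
    proof (cases "logp (nev_T f r) \<le> 1")
      case False
      hence "ln (logp (nev_T f r)) < \<sigma> * ln (ln r)" using * by (simp add: logp_def[of "logp _"])
      also have "\<dots> = ln (ln r powr \<sigma>)" using lr1 by (simp add: ln_powr)
      finally show ?thesis using False one by (subst (asm) ln_less_cancel_iff) auto
    qed (use one in linarith)
    moreover have "nev_T f r \<le> exp (logp (nev_T f r))" by (simp add: logp_def)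
    ultimately show ?case by (meson exp_le_cancel_iff order_trans)
  qed
  then obtain r0 where "\<And>r. r0 \<le> r \<Longrightarrow> nev_T f r \<le> exp (ln r powr \<sigma>)"
    by (auto simp: eventually_at_top_linorder)
  thus ?thesis using that[of \<sigma> r0] s by simp
qed

text \<open>A slightly larger exponent pays for moving r to a noncritical radius in [r, r + 1] and
  for the additive constant of Jensen's inequality.\<close>

lemma exp_powr_absorb:
  fixes \<sigma> \<tau> C :: real
  assumes "0 < \<sigma>" "\<sigma> < \<tau>" "0 \<le> C"
  shows "\<forall>\<^sub>F r in at_top. exp (ln (r + 1) powr \<sigma>) + C \<le> exp (ln r powr \<tau>)"
proof -
  \<comment> \<open>From exp X + C \<le> exp (X + C) for X \<ge> 0 and ln (r + 1) \<le> 2 ln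
    r.\<close>
  define K :: real where "K = 2 powr \<sigma> + C"
  have K: "0 < K" using assms by (simp add: K_def add_pos_nonneg)
  have "\<forall>\<^sub>F r :: real in at_top. K powr (1 / (\<tau> - \<sigma>)) \<le> ln r"
    using ln_at_top by (simp add: filterlim_at_top)
  hence "\<forall>\<^sub>F r in at_top. 2 powr \<sigma> + C \<le> ln r powr (\<tau> - \<sigma>)"
  proof eventually_elim
    case (elim r)
    have "K = (K powr (1 / (\<tau> - \<sigma>))) powr (\<tau> - \<sigma>)" using K assms by (simp add: powr_powr)
    also have "\<dots> \<le> ln r powr (\<tau> - \<sigma>)" using elim assms by (intro powr_mono2) auto
    finally show ?case by (simp add: K_def)
  qed
  moreover have "\<forall>\<^sub>F r::real in at_top. max 2 (exp 1) \<le> r" by (rule eventually_ge_at_top)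
  ultimately show ?thesis
  proof eventually_elim
    case (elim r)
    define L where "L = ln r"
    have r: "2 \<le> r" "exp 1 \<le> r" using elim by auto
    have L: "1 \<le> L" unfolding L_def using r by (subst ln_ge_iff) auto
    have "2 * r \<le> r * r" using r(1) by (intro mult_right_mono) auto
    hence "r + 1 \<le> r ^ 2" using r(1) unfolding power2_eq_square by linarith
    hence "ln (r + 1) \<le> ln (r ^ 2)" using r by (subst ln_le_cancel_iff) auto
    hence "ln (r + 1) powr \<sigma> \<le> (2 * L) powr \<sigma>"
      using r assms by (intro powr_mono2) (auto simp: L_def ln_realpow)
    also have "\<dots> = 2 powr \<sigma> * L powr \<sigma>" using L by (simp add: powr_mult)
    finally have 1: "ln (r + 1) powr \<sigma> \<le> 2 powr \<sigma> * L powr \<sigma>" .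
    have one: "1 \<le> L powr \<sigma>" using L assms by (intro ge_one_powr_ge_zero) auto
    have "exp (ln (r + 1) powr \<sigma>) + C \<le> exp (ln (r + 1) powr \<sigma>) + C * exp (ln (r + 1) powr \<sigma>)"
      using assms(3) by (simp add: mult_le_cancel_left1)
    also have "\<dots> = exp (ln (r + 1) powr \<sigma>) * (1 + C)" by (simp add: algebra_simps)
    also have "\<dots> \<le> exp (ln (r + 1) powr \<sigma>) * exp C"
      by (intro mult_left_mono exp_ge_add_one_self) auto
    also have "\<dots> = exp (ln (r + 1) powr \<sigma> + C)" by (simp add: exp_add)
    also have "ln (r + 1) powr \<sigma> + C \<le> 2 powr \<sigma> * L powr \<sigma> + C * L powr \<sigma>"
      using 1 one assms(3) by (intro add_mono) (auto simp: mult_le_cancel_left1)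
    also have "\<dots> = (2 powr \<sigma> + C) * L powr \<sigma>" by (simp add: algebra_simps)
    also have "\<dots> \<le> L powr (\<tau> - \<sigma>) * L powr \<sigma>" using elim by (intro mult_right_mono) (auto simp: L_def)
    also have "\<dots> = L powr \<tau>" by (simp flip: powr_add)
    finally show ?case by (simp add: L_def)
  qed
qed

lemma exceptional_set_Un_countable:
  assumes F: "F \<in> sets lborel" "F \<subseteq> {1<..}"
      "(\<integral>\<^sup>+ t. indicator F t * ennreal (1 / (t * ln t)) \<partial>lborel) < \<infinity>"
    and B: "countable B"
  shows "F \<union> (B \<inter> {1<..}) \<in> sets lborel" "F \<union> (B \<inter> {1<..}) \<subseteq> {1<..}"
    "(\<integral>\<^sup>+ t. indicator (F \<union> (B \<inter> {1<..})) t * ennreal (1 / (t * ln t)) \<partial>lborel) < \<infinity>"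
proof -
  have c: "countable (B \<inter> {1<..})" using B by auto
  have null: "B \<inter> {1<..} \<in> null_sets lborel" using c by (rule countable_imp_null_set_lborel)
  thus "F \<union> (B \<inter> {1<..}) \<in> sets lborel" using F(1) by auto
  show "F \<union> (B \<inter> {1<..}) \<subseteq> {1<..}" using F(2) by auto
  have "AE t in lborel. t \<notin> B \<inter> {1<..}" using null by (rule AE_not_in)
  hence "(\<integral>\<^sup>+ t. indicator (F \<union> (B \<inter> {1<..})) t * ennreal (1 / (t * ln t)) \<partial>lborel)
      = (\<integral>\<^sup>+ t. indicator F t * ennreal (1 / (t * ln t)) \<partial>lborel)"
    by (intro nn_integral_cong_AE) (auto elim!: eventually_mono simp: indicator_def)
  thus "(\<integral>\<^sup>+ t. indicator (F \<union> (B \<inter> {1<..})) t * ennreal (1 / (t * ln t)) \<partial>lborel) < \<infinity>"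
    using F(3) by simp
qed

theorem theorem5p3:
  fixes f :: "complex \<Rightarrow> complex" and q p :: complex
  assumes "0 < cmod q" and "cmod q < 1" and "p\<^sup>2 = q"
    and "f nicely_meromorphic_on UNIV"
    and "\<not> (\<exists>c. \<forall>x. f x = c)"
    and "sigma2_log f < 1"
  shows "\<forall>a :: complex option. \<exists>F C R.
           F \<in> sets lborel \<and> F \<subseteq> {1<..} \<and>
           (\<integral>\<^sup>+ t. indicator F t * ennreal (1 / (t * ln t)) \<partial>lborel) < \<infinity> \<and>
           (\<forall>r. R < r \<and> r \<notin> F \<longrightarrow>
              \<bar>N_AW_M p 1 (fsub f a) r - N_AW p (fsub f a) r\<bar>
                \<le> C * (nev_T f r / ln (ln r) + ln r))"
proof
  fix a :: "complex option"
  note f = assms(4,5)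
  define g where "g = fsub f a"
  interpret nonzero_meromorphic g unfolding g_def by (rule nonzero_meromorphic_fsub[OF f])
  have p: "p \<noteq> 0" "cmod p < 1"
  proof -
    show "p \<noteq> 0" using assms(1,3) by auto
    have "(cmod p)\<^sup>2 < 1\<^sup>2" using assms(2,3) by (simp flip: norm_power)
    thus "cmod p < 1" by (rule power_less_imp_less_base) simp
  qed
  define n where "n = int_count (zero_mult g)"
  have n_mono: "n r \<le> n s" if "0 < r" "r \<le> s" for r s
    unfolding n_def by (rule int_count_mono[OF finite_zero_mult zero_mult_nonneg that])
  obtain C1 where C1: "\<And>r. 0 < r \<Longrightarrow> r \<notin> critical_radii \<Longrightarrow> n r \<le> nev_T f r + C1"
    using int_count_zeros_le_nev_T[OF f, of a] unfolding n_def g_def by blast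
  obtain C2 \<kappa> where \<kappa>: "1 \<le> \<kappa>" and C2: "\<And>r. exp 1 \<le> r \<Longrightarrow> \<bar>N_AW_M p 1 g r - N_AW p g r\<bar>
      \<le> C2 * ln r + ln \<kappa> * disc_count (zero_mult g) (\<kappa> * r)"
    using aw_counting_difference[OF p] by blast
  obtain \<sigma> r0 where \<sigma>: "0 < \<sigma>" "\<sigma> < 1" and T: "\<And>r. r0 \<le> r \<Longrightarrow> nev_T f r \<le> exp (ln r powr \<sigma>)"
    using sigma2_log_less_1_bound[OF assms(6)] by blast
  obtain \<tau> where \<tau>: "\<sigma> < \<tau>" "\<tau> < 1" using dense[OF \<sigma>(2)] by blast
  have "\<forall>\<^sub>F r in at_top. exp (ln (r + 1) powr \<sigma>) + (\<bar>C1\<bar> + 1) \<le> exp (ln r powr \<tau>)"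
    using \<sigma> \<tau> by (intro exp_powr_absorb) auto
  then obtain r1 where r1: "\<And>r. r1 \<le> r \<Longrightarrow> exp (ln (r + 1) powr \<sigma>) + (\<bar>C1\<bar> + 1) \<le> exp (ln r powr \<tau>)"
    by (auto simp: eventually_at_top_linorder)
  \<comment> \<open>The growth lemma needs the bound at every large radius. An interval of length 1
    is uncountable and so contains a noncritical s, and \<open>n\<close> is increasing.\<close>
  have growth: "n r + 1 \<le> exp (ln r powr \<tau>)" if r: "max (max r0 r1) 1 \<le> r" for r
  proof -
    have "\<not> {r..r + 1} \<subseteq> critical_radii"
      using countable_critical_radii countable_subset uncountable_closed_interval[of r "r + 1"] by auto
    then obtain s where "s \<in> {r..r + 1}" "s \<notin> critical_radii" by blast
    hence s: "r \<le> s" "s \<le> r + 1" "s \<notin> critical_radii" by auto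
    have "n r \<le> n s" using r s by (intro n_mono) auto
    also have "\<dots> \<le> nev_T f s + C1" using r s by (intro C1) auto
    also have "nev_T f s \<le> exp (ln s powr \<sigma>)" using r s by (intro T) auto
    also have "\<dots> \<le> exp (ln (r + 1) powr \<sigma>)"
      using r s \<sigma> by (simp add: powr_mono2)
    finally show ?thesis using r1[of r] r by auto
  qed
  obtain F0 R0 where F0: "F0 \<in> sets lborel" "F0 \<subseteq> {1<..}"
     "(\<integral>\<^sup>+ t. indicator F0 t * ennreal (1 / (t * ln t)) \<partial>lborel) < \<infinity>"
     and R0: "\<And>r. R0 < r \<Longrightarrow> r \<notin> F0 \<Longrightarrow> n (r * (ln r)\<^sup>2) + 1 \<le> 2 * (n r + 1)"
  proof -
    have "1 \<le> n r + 1" if "1 \<le> r" for r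
      using int_count_nonneg[OF finite_zero_mult zero_mult_nonneg that] by (simp add: n_def)
    moreover have "n r + 1 \<le> n s + 1" if "1 \<le> r" "r \<le> s" for r s using n_mono[of r s] that by simp
    ultimately have "\<exists>F R. F \<in> sets lborel \<and> F \<subseteq> {1<..} \<and>
       (\<integral>\<^sup>+ t. indicator F t * ennreal (1 / (t * ln t)) \<partial>lborel) < \<infinity> \<and>
       (\<forall>r. R < r \<and> r \<notin> F \<longrightarrow> n (r * (ln r)\<^sup>2) + 1 \<le> 2 * (n r + 1))"
      using \<sigma> \<tau> growth by (intro borel_growth[where \<sigma> = \<tau> and ?r0.0 = "max (max r0 r1) 1"]) auto
    thus ?thesis using that by blast
  qed
  define F where "F = F0 \<union> (critical_radii \<inter> {1<..})"
  note F = exceptional_set_Un_countable[OF F0 countable_critical_radii, folded F_def]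
  \<comment> \<open>2 |C1| + 2 comes from n(r (ln r)^2) \<le> 2 n(r) + 1 \<le> 2 (T + |C1|) + 1, as
    one coefficient for both error terms.\<close>
  define C where "C = \<bar>C2\<bar> + ln \<kappa> * (2 * \<bar>C1\<bar> + 2)"
  have lk: "0 \<le> ln \<kappa>" using \<kappa> by simp
  \<comment> \<open>exp (exp 1) < r gives ln (ln r) > 1, and exp \<kappa> < r gives the condition
    \<kappa> \<le> ln r of the zero-count bound.\<close>
  have main: "\<bar>N_AW_M p 1 g r - N_AW p g r\<bar> \<le> C * (nev_T f r / ln (ln r) + ln r)"
    if r: "max R0 (max (exp (exp 1)) (exp \<kappa>)) < r" "r \<notin> F" for r
  proof -
    have re: "exp (exp 1) < r" "R0 < r" "exp \<kappa> < r" using r(1) by auto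
    have r0: "0 < r" using re(1) by (rule less_trans[rotated]) simp
    have l: "exp 1 < ln r" "\<kappa> < ln r"
      using re r0 by (metis exp_less_cancel_iff exp_ln)+
    have l1: "1 < ln r" using l(1) one_le_exp_iff[of "1::real"] by linarith
    have r1: "1 < r" using l1 r0 ln_gt_zero_iff[of r] by linarith
    have e1: "exp 1 < r" using l1 r0 by (metis exp_less_cancel_iff exp_ln)
    have ll: "1 < ln (ln r)" using l(1) l1 by (metis exp_less_cancel_iff exp_ln less_trans zero_less_one)
    have nF: "r \<notin> F0" "r \<notin> critical_radii" using r(2) r1 by (auto simp: F_def)
    define Tr where "Tr = nev_T f r"
    have T0: "0 \<le> Tr"
      using nev_m_nonneg[of f r] nev_N_nonneg[of f r] nonzero_meromorphic_fsub[OF f, of "Some 0"] r1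
      by (simp add: Tr_def nev_T_def)
    have "ln (ln r) * disc_count (zero_mult g) (\<kappa> * r) \<le> n (r * (ln r)\<^sup>2)"
      unfolding n_def using e1 l by (intro disc_count_le_int_count finite_zero_mult zero_mult_nonneg \<kappa>) auto
    also have "\<dots> \<le> 2 * n r + 1" using R0[OF re(2) nF(1)] by simp
    also have "\<dots> \<le> 2 * (Tr + \<bar>C1\<bar>) + 1" using C1[OF r0 nF(2)] by (simp add: Tr_def)
    finally have "disc_count (zero_mult g) (\<kappa> * r) \<le> (2 * (Tr + \<bar>C1\<bar>) + 1) / ln (ln r)"
      using ll by (simp add: field_simps)
    also have "\<dots> = 2 * (Tr / ln (ln r)) + (2 * \<bar>C1\<bar> + 1) / ln (ln r)"
      by (simp add: add_divide_distrib)
    also have "(2 * \<bar>C1\<bar> + 1) / ln (ln r) \<le> 2 * \<bar>C1\<bar> + 1"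
      using divide_left_mono[of 1 "ln (ln r)" "2 * \<bar>C1\<bar> + 1"] ll by simp
    also have "2 * \<bar>C1\<bar> + 1 \<le> (2 * \<bar>C1\<bar> + 2) * ln r"
    proof -
      have "2 * \<bar>C1\<bar> + 1 \<le> (2 * \<bar>C1\<bar> + 2) * 1" by simp
      also have "\<dots> \<le> (2 * \<bar>C1\<bar> + 2) * ln r" using l1 by (intro mult_left_mono) auto
      finally show ?thesis .
    qed
    also have "2 * (Tr / ln (ln r)) \<le> (2 * \<bar>C1\<bar> + 2) * (Tr / ln (ln r))"
      using T0 ll by (intro mult_right_mono) auto
    finally have "disc_count (zero_mult g) (\<kappa> * r) \<le> (2 * \<bar>C1\<bar> + 2) * (Tr / ln (ln r) + ln r)"
      by (simp add: distrib_left)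
    hence d: "ln \<kappa> * disc_count (zero_mult g) (\<kappa> * r) \<le> ln \<kappa> * ((2 * \<bar>C1\<bar> + 2) * (Tr / ln (ln r) + ln r))"
      using lk by (rule mult_left_mono)
    have "C2 * ln r \<le> \<bar>C2\<bar> * (Tr / ln (ln r) + ln r)"
      using T0 ll l1 by (intro mult_mono) auto
    with d C2[of r] e1 have "\<bar>N_AW_M p 1 g r - N_AW p g r\<bar> \<le>
        \<bar>C2\<bar> * (Tr / ln (ln r) + ln r) + ln \<kappa> * ((2 * \<bar>C1\<bar> + 2) * (Tr / ln (ln r) + ln r))"
      by linarith
    thus ?thesis by (simp add: C_def Tr_def distrib_right mult.assoc)
  qed
  show "\<exists>F C R. F \<in> sets lborel \<and> F \<subseteq> {1<..} \<and>
           (\<integral>\<^sup>+ t. indicator F t * ennreal (1 / (t * ln t)) \<partial>lborel) < \<infinity> \<and>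
           (\<forall>r. R < r \<and> r \<notin> F \<longrightarrow>
              \<bar>N_AW_M p 1 (fsub f a) r - N_AW p (fsub f a) r\<bar>
                \<le> C * (nev_T f r / ln (ln r) + ln r))"
    using F main unfolding g_def by blast
qed

end
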